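(* Let $d\ge1$, and let the environment satisfy the standing assumptions (A1)–(A3) of the context. With $f$, $\lambda(\theta)$, $\bar\lambda(\theta)$ and $\beta$ as defined in the context, for every $m\in\mathbb{Z}^d\setminus\{0\}$ $$\mathrm{Cov}_{\mathbb{P}}[f(\omega),f(T_{m,0}\omega)]=-\frac{\beta^{-1}}{(2\pi)^d}\int_{\mathbb{T}^d}\cos(\theta\cdot m)\,\frac{1-\lambda(\theta)}{1-\bar\lambda(\theta)}\,d\theta,$$ and $$\mathrm{Var}_{\mathbb{P}}[f(\omega)]=\beta^{-1}-1.$$
   Context: Environment. Fix $d\ge1$ and a finite constant $R$. An environment is $\omega=(\omega_{x,s})_{(x,s)\in\mathbb{Z}^d\times\mathbb{Z}}$ where each $\omega_{x,s}=(\omega_{x,s}(z):z\in\mathbb{Z}^d,|z|\le R)$ is a probability vector. $\Omega$ is the space of environments with product topology and Borel $\sigma$-algebra, and $(T_{x,s}\omega)_{y,t}=\omega_{x+y,s+t}$. One-step transition probabilities are $\pi^\omega_{s,s+1}(x,y)=\omega_{x,s}(y-x)$ (zero if $|y-x|>R$), and $\pi^\omega_{s,t}(x,y)$ denotes the multistep transition probability obtained by composing one-step transitions. $\mathbb{P}$ is a probability measure on $\Omega$ with expectation $\mathbb{E}$. Let $p(u)=\mathbb{E}[\omega_{0,0}(u)]$. Standing assumptions. (A1) The vectors $(\omega_{x,s})_{(x,s)}$ are i.i.d. under $\mathbb{P}$. (A2) $\mathbb{P}\{\exists z\in\mathbb{Z}^d: 0<\omega_{0,0}(z)<1\}>0$.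 (A3) There do not exist $x\in\mathbb{Z}^d$ and an additive subgroup $\mathbb{G}\subsetneq\mathbb{Z}^d$ such that $\sum_{z\in\mathbb{G}}p(x+z)=1$. Density $f$. Set $f_N(\omega)=\sum_{z\in\mathbb{Z}^d}\pi^\omega_{-N,0}(z,0)$, a nonnegative martingale in $N$, and $f=\lim_{N\to\infty}f_N$ ($\mathbb{P}$-a.s.). It satisfies $\mathbb{E}f=1$ and $\mathbb{E}(f^2)<\infty$. Characteristic functions. For $\theta\in\mathbb{T}^d=(-\pi,\pi]^d$ let $\phi^\omega(\theta)=\sum_z\omega_{0,0}(z)e^{i\theta\cdot z}$, $\lambda(\theta)=\mathbb{E}|\phi^\omega(\theta)|^2$, $\bar\lambda(\theta)=|\mathbb{E}\phi^\omega(\theta)|^2$. (Under (A3), $\bar\lambda(\theta)<1$ for $\theta\ne0$.) Define $$\beta=\frac1{(2\pi)^d}\int_{\mathbb{T}^d}\frac{1-\lambda(\theta)}{1-\bar\lambda(\theta)}\,d\theta\in(0,1].$$ *)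

theory Defs
  imports "HOL-Probability.Probability"
begin

text \<open>An environment assigns to each space-time point a jump distribution on the integer lattice.
  Jump vectors live on the full lattice and vanish outside the range \<open>R\<close>; since all jump
  vectors of an environment in \<open>environments R\<close> have finite support, every infinite sum below
  has only finitely many nonzero terms there.\<close>

type_synonym 'd env = "(int ^ 'd) \<times> int \<Rightarrow> int ^ 'd \<Rightarrow> real"

definition real_vec :: "int ^ 'd \<Rightarrow> real ^ 'd" where
  "real_vec z = (\<chi> i. real_of_int (z $ i))"

definition prob_vectors :: "real \<Rightarrow> (int ^ 'd::finite \<Rightarrow> real) set" where
  "prob_vectors R = {q. (\<forall>z. 0 \<le> q z) \<and> (\<forall>z. norm (real_vec z) > R \<longrightarrow> q z = 0) \<and>
     (\<Sum>z | norm (real_vec z) \<le> R. q z) = 1}"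

definition environments :: "real \<Rightarrow> ('d::finite) env set" where
  "environments R = {\<omega>. \<forall>x s. \<omega> (x, s) \<in> prob_vectors R}"

text \<open>The Borel sigma-algebra of the product topology, which is the topology of the function type.\<close>

definition env_space :: "real \<Rightarrow> ('d::finite) env measure" where
  "env_space R = restrict_space borel (environments R)"

definition env_shift :: "int ^ 'd \<Rightarrow> int \<Rightarrow> ('d::finite) env \<Rightarrow> 'd env" where
  "env_shift x s \<omega> = (\<lambda>(y, t). \<omega> (x + y, s + t))"

definition step_prob :: "('d::finite) env \<Rightarrow> int \<Rightarrow> int ^ 'd \<Rightarrow> int ^ 'd \<Rightarrow> real" where
  "step_prob \<omega> s x y = \<omega> (x, s) (y - x)"

text \<open>\<open>steps_prob \<omega> s n x y\<close> is the transition probability from \<open>x\<close> at time \<open>s\<close>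
  to \<open>y\<close> at time \<open>s + n\<close>.\<close>

primrec steps_prob :: "('d::finite) env \<Rightarrow> int \<Rightarrow> nat \<Rightarrow> int ^ 'd \<Rightarrow> int ^ 'd \<Rightarrow> real" where
  "steps_prob \<omega> s 0 x y = (if x = y then 1 else 0)"
| "steps_prob \<omega> s (Suc n) x y =
     (\<Sum>\<^sub>\<infinity>z. steps_prob \<omega> s n x z * step_prob \<omega> (s + int n) z y)"

definition quenched_density_approx :: "nat \<Rightarrow> ('d::finite) env \<Rightarrow> real" where
  "quenched_density_approx N \<omega> = (\<Sum>\<^sub>\<infinity>z. steps_prob \<omega> (- int N) N z 0)"

text \<open>The limit exists almost surely by martingale convergence; elsewhere the value is an
  unspecified constant.\<close>

definition quenched_density :: "('d::finite) env \<Rightarrow> real" where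
  "quenched_density \<omega> = lim (\<lambda>N. quenched_density_approx N \<omega>)"

definition iid_environment :: "('d::finite) env measure \<Rightarrow> bool" where
  "iid_environment P \<longleftrightarrow>
     prob_space.indep_vars P (\<lambda>_. borel) (\<lambda>i \<omega>. \<omega> i) UNIV \<and>
     (\<forall>i j. distr P borel (\<lambda>\<omega>. \<omega> i) = distr P borel (\<lambda>\<omega>. \<omega> j))"

definition nondegenerate_environment :: "('d::finite) env measure \<Rightarrow> bool" where
  "nondegenerate_environment P \<longleftrightarrow>
     measure P {\<omega> \<in> space P. \<exists>z. 0 < \<omega> (0, 0) z \<and> \<omega> (0, 0) z < 1} > 0"

definition mean_kernel :: "('d::finite) env measure \<Rightarrow> int ^ 'd \<Rightarrow> real" where
  "mean_kernel P u = (\<integral>\<omega>. \<omega> (0, 0) u \<partial>P)"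

definition add_subgroup :: "'a::ab_group_add set \<Rightarrow> bool" where
  "add_subgroup G \<longleftrightarrow> 0 \<in> G \<and> (\<forall>x\<in>G. \<forall>y\<in>G. x + y \<in> G) \<and> (\<forall>x\<in>G. - x \<in> G)"

definition aperiodic_environment :: "('d::finite) env measure \<Rightarrow> bool" where
  "aperiodic_environment P \<longleftrightarrow>
     \<not> (\<exists>x G. add_subgroup G \<and> G \<subset> UNIV \<and> (\<Sum>\<^sub>\<infinity>z\<in>G. mean_kernel P (x + z)) = 1)"

definition char_fun :: "('d::finite) env \<Rightarrow> real ^ 'd \<Rightarrow> complex" where
  "char_fun \<omega> \<theta> = (\<Sum>\<^sub>\<infinity>z. complex_of_real (\<omega> (0, 0) z) * cis (\<theta> \<bullet> real_vec z))"

definition lam :: "('d::finite) env measure \<Rightarrow> real ^ 'd \<Rightarrow> real" where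
  "lam P \<theta> = (\<integral>\<omega>. (cmod (char_fun \<omega> \<theta>))\<^sup>2 \<partial>P)"

definition lam_bar :: "('d::finite) env measure \<Rightarrow> real ^ 'd \<Rightarrow> real" where
  "lam_bar P \<theta> = (cmod (\<integral>\<omega>. char_fun \<omega> \<theta> \<partial>P))\<^sup>2"

definition torus :: "(real ^ 'd) set" where
  "torus = {\<theta>. \<forall>i. - pi < \<theta> $ i \<and> \<theta> $ i \<le> pi}"

text \<open>At \<open>\<theta> = 0\<close>, a null set, the integrand is \<open>0 / 0 = 0\<close>.\<close>

definition beta :: "('d::finite) env measure \<Rightarrow> real" where
  "beta P = 1 / (2 * pi) ^ CARD('d) *
     (LINT \<theta>:torus|lborel. (1 - lam P \<theta>) / (1 - lam_bar P \<theta>))"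

definition (in prob_space) covariance :: "('a \<Rightarrow> real) \<Rightarrow> ('a \<Rightarrow> real) \<Rightarrow> real" where
  "covariance X Y = expectation (\<lambda>\<omega>. (X \<omega> - expectation X) * (Y \<omega> - expectation Y))"

end

theory Submission
  imports Defs
begin

text \<open>Let \<open>f\<^sub>N(x)\<close> be the mass that arrives at site \<open>x\<close> at time \<open>0\<close> when every site starts with unit mass at
  time \<open>-N\<close>, and let \<open>h\<^sub>N(m) = E[f\<^sub>N(0) f\<^sub>N(m)]\<close>. The jump vectors used in the last step are
  independent of the past, so \<open>h\<^sub>N\<close> satisfies a closed linear recursion (\<open>expectation_mass_mult\<close>): it
  evolves under the difference of two independent walks, except that two walks at the same site use
  the same jump vector. For the Fourier transform \<open>g\<^sub>N\<close> of \<open>h\<^sub>N - 1\<close> this becomes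

  \<open>g\<^sub>N\<^sub>+\<^sub>1 = \<lambda>' g\<^sub>N + h\<^sub>N(0) (\<lambda> - \<lambda>')\<close>, with \<open>g\<^sub>0 = 0\<close>,

  where \<open>\<lambda>\<close> is \<open>lam P\<close> and \<open>\<lambda>'\<close> is \<open>lam_bar P\<close>, the squared modulus of the mean characteristic function
  (\<open>correlation_hat_fourier_complex\<close>). For each \<open>\<theta>\<close> with \<open>\<lambda>'(\<theta>) < 1\<close> this is a scalar affine
  recursion.

  The sequence \<open>h\<^sub>N(0)\<close> consists of the second moments of the martingale \<open>f\<^sub>N(0)\<close> and is therefore
  increasing. Hence \<open>g\<^sub>N \<le> h\<^sub>N(0) (\<lambda> - \<lambda>') / (1 - \<lambda>')\<close>, and integration over the torus gives
  \<open>h\<^sub>N(0) - 1 \<le> h\<^sub>N(0) (1 - \<beta>)\<close>, that is, \<open>h\<^sub>N(0) \<le> 1 / \<beta>\<close>. Nondegeneracy makes \<open>\<lambda> < 1\<close> almost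
  everywhere, hence \<open>\<beta> > 0\<close> and \<open>h\<^sub>N(0)\<close> has a finite limit \<open>a\<close>. Then
  \<open>g\<^sub>N\<close> tends to \<open>a (\<lambda> - \<lambda>') / (1 - \<lambda>') = a (1 - (1 - \<lambda>) / (1 - \<lambda>'))\<close>; the Fourier coefficient
  at \<open>0\<close> gives \<open>a - 1 = a (1 - \<beta>)\<close>, so \<open>a = 1 / \<beta>\<close>, and the other coefficients are the claimed
  covariances (\<open>correlation_limit\<close>).

  It remains to pass from \<open>f\<^sub>N\<close> to its limit \<open>f\<close>. Both \<open>f\<^sub>N(0)\<close> and \<open>f\<^sub>N(0) + f\<^sub>N(m)\<close> are martingales
  with bounded second moments. Kolmogorov's maximal inequality gives almost sure convergence
  (\<open>AE_convergent\<close>), Fatou's lemma upgrades it to convergence in mean square (\<open>limit_moments\<close>), and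
  polarisation yields the covariance of the limits (\<open>limit_mass_covariance\<close>).\<close>

section \<open>Bounded functions on a probability space\<close>

lemma bounded_mult_comp:
  fixes f g :: "'a \<Rightarrow> real"
  assumes "bounded (f ` S)" "bounded (g ` S)"
  shows "bounded ((\<lambda>x. f x * g x) ` S)"
proof -
  from assms obtain C D where "\<And>x. x \<in> S \<Longrightarrow> \<bar>f x\<bar> \<le> C" "\<And>x. x \<in> S \<Longrightarrow> \<bar>g x\<bar> \<le> D"
    unfolding bounded_real by auto
  then have "\<bar>f x * g x\<bar> \<le> C * D" if "x \<in> S" for x
    unfolding abs_mult using that by (intro mult_mono) (auto intro: order_trans[OF abs_ge_zero])
  then show ?thesis unfolding bounded_real by auto
qed

lemma bounded_sum_comp:
  fixes f :: "'i \<Rightarrow> 'a \<Rightarrow> real"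
  assumes "\<And>i. i \<in> I \<Longrightarrow> bounded (f i ` S)"
  shows "bounded ((\<lambda>x. \<Sum>i\<in>I. f i x) ` S)"
  using assms
proof (induction I rule: infinite_finite_induct)
  case (insert i I)
  then have "bounded ((\<lambda>x. f i x + (\<Sum>j\<in>I. f j x)) ` S)"
    by (intro bounded_plus_comp) auto
  with insert show ?case by simp
qed (auto simp: bounded_real)

lemma bounded_const_comp: "bounded ((\<lambda>x. c::real) ` S)"
  by (auto simp: bounded_real)

lemma bounded_of_bool_comp: "bounded ((\<lambda>x. of_bool (Q x) :: real) ` S)"
  unfolding bounded_real by (auto intro!: exI[of _ 1])

lemmas bounded_comps = bounded_plus_comp bounded_minus_comp bounded_mult_comp bounded_sum_comp
  bounded_const_comp bounded_of_bool_comp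

lemma (in finite_measure) integrable_of_bounded:
  fixes f :: "'a \<Rightarrow> real"
  assumes "f \<in> borel_measurable M" "bounded (f ` space M)"
  shows "integrable M f"
proof -
  from assms(2) obtain C where "\<And>x. x \<in> space M \<Longrightarrow> \<bar>f x\<bar> \<le> C"
    unfolding bounded_real by auto
  then show ?thesis by (intro integrable_const_bound[of _ C]) (use assms in auto)
qed

section \<open>Square-bounded martingales\<close>

text \<open>A martingale with respect to its own history, each term of which is bounded. The martingale
  property is tested against functions \<open>\<phi>\<close> of the history \<open>X 0, \<dots>, X n\<close> instead of being phrased
  with conditional expectations: the history is passed as the sequence stopped at time \<open>n\<close>, so that
  \<open>\<phi>\<close> has one type for all \<open>n\<close>. In this form the property follows from plain independence
  computations.\<close>

locale bounded_martingale = prob_space M for M :: "'a measure" +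
  fixes X :: "nat \<Rightarrow> 'a \<Rightarrow> real"
  assumes meas [measurable]: "X n \<in> borel_measurable M"
    and bdd: "bounded (X n ` space M)"
    and mart: "\<phi> \<in> borel_measurable (borel :: (nat \<Rightarrow> real) measure) \<Longrightarrow>
      bounded ((\<lambda>\<omega>. \<phi> (\<lambda>k. X (min k n) \<omega>)) ` space M) \<Longrightarrow>
      expectation (\<lambda>\<omega>. X (Suc n) \<omega> * \<phi> (\<lambda>k. X (min k n) \<omega>)) =
      expectation (\<lambda>\<omega>. X n \<omega> * \<phi> (\<lambda>k. X (min k n) \<omega>))"
begin

lemma history_measurable [measurable]: "(\<lambda>\<omega> k. X (min k n) \<omega>) \<in> measurable M borel"
  by (rule measurable_coordinatewise_then_product) measurable

lemma mart_le:
  assumes "n \<le> N" and \<phi>[measurable]: "\<phi> \<in> borel_measurable (borel :: (nat \<Rightarrow> real) measure)"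
    and b: "bounded ((\<lambda>\<omega>. \<phi> (\<lambda>k. X (min k n) \<omega>)) ` space M)"
  shows "expectation (\<lambda>\<omega>. X N \<omega> * \<phi> (\<lambda>k. X (min k n) \<omega>)) =
    expectation (\<lambda>\<omega>. X n \<omega> * \<phi> (\<lambda>k. X (min k n) \<omega>))"
  using assms(1)
proof (induction N rule: dec_induct)
  case (step N)
  let ?\<psi> = "\<lambda>h::nat \<Rightarrow> real. \<phi> (\<lambda>k. h (min k n))"
  have eq: "?\<psi> (\<lambda>k. X (min k N) \<omega>) = \<phi> (\<lambda>k. X (min k n) \<omega>)" for \<omega>
    using step(1) by (simp add: min.absorb1 min.assoc)
  have [measurable]: "(\<lambda>h::nat \<Rightarrow> real. (\<lambda>k. h (min k n))) \<in> borel_measurable borel"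
    by (rule measurable_coordinatewise_then_product) measurable
  have "?\<psi> \<in> borel_measurable borel" by measurable
  from mart[OF this, of N] b step.IH show ?case unfolding eq by simp
qed simp

lemma integrable_mult_X:
  "f \<in> borel_measurable M \<Longrightarrow> bounded (f ` space M) \<Longrightarrow> integrable M (\<lambda>\<omega>. X n \<omega> * f \<omega>)"
  by (intro integrable_of_bounded bounded_comps bdd) auto

lemma expectation_X: "expectation (X n) = expectation (X 0)"
  using mart_le[of 0 n "\<lambda>_. 1"] by (simp add: bounded_comps)

lemma expectation_square_diff:
  assumes "n \<le> N"
  shows "expectation (\<lambda>\<omega>. (X N \<omega> - X n \<omega>)\<^sup>2) =
    expectation (\<lambda>\<omega>. (X N \<omega>)\<^sup>2) - expectation (\<lambda>\<omega>. (X n \<omega>)\<^sup>2)"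
proof -
  have *: "expectation (\<lambda>\<omega>. X N \<omega> * X n \<omega>) = expectation (\<lambda>\<omega>. X n \<omega> * X n \<omega>)"
    using mart_le[OF assms, of "\<lambda>h. h n"] bdd[of n] by simp
  have [simp]: "integrable M (\<lambda>\<omega>. X i \<omega> * X j \<omega>)" for i j
    by (intro integrable_mult_X bdd) measurable
  have "expectation (\<lambda>\<omega>. (X N \<omega> - X n \<omega>)\<^sup>2) =
    expectation (\<lambda>\<omega>. X N \<omega> * X N \<omega> - 2 * (X N \<omega> * X n \<omega>) + X n \<omega> * X n \<omega>)"
    by (intro Bochner_Integration.integral_cong) (auto simp: power2_eq_square algebra_simps)
  also have "\<dots> = expectation (\<lambda>\<omega>. X N \<omega> * X N \<omega>) - 2 * expectation (\<lambda>\<omega>. X N \<omega> * X n \<omega>)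
      + expectation (\<lambda>\<omega>. X n \<omega> * X n \<omega>)"
    by simp
  finally show ?thesis using * by (simp add: power2_eq_square)
qed

lemma expectation_square_mono: "mono (\<lambda>n. expectation (\<lambda>\<omega>. (X n \<omega>)\<^sup>2))"
proof (rule monoI)
  fix n N :: nat assume "n \<le> N"
  from expectation_square_diff[OF this] show "expectation (\<lambda>\<omega>. (X n \<omega>)\<^sup>2) \<le> expectation (\<lambda>\<omega>. (X N \<omega>)\<^sup>2)"
    using Bochner_Integration.integral_nonneg[of M "\<lambda>\<omega>. (X N \<omega> - X n \<omega>)\<^sup>2"] by simp
qed

text \<open>Kolmogorov's maximal inequality. Let \<open>b k\<close> indicate that level \<open>\<epsilon>\<close> has been reached by time \<open>k\<close>.
  By induction on \<open>k\<close>, \<open>\<epsilon>\<^sup>2 E[b k] \<le> E[D k\<^sup>2 b k]\<close>: on the event \<open>b k = 1\<close> the mean square of the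
  increment \<open>D\<close> can only grow, since \<open>D (k+1)\<^sup>2 \<ge> D k\<^sup>2 + 2 D k (D (k+1) - D k)\<close> and the cross term has
  mean zero; on the event that the level is first reached at time \<open>k+1\<close>, \<open>D (k+1)\<^sup>2 \<ge> \<epsilon>\<^sup>2\<close>.\<close>

lemma maximal_inequality:
  assumes "m \<le> n" and \<epsilon>: "\<epsilon> > 0"
  shows "\<epsilon>\<^sup>2 * prob {\<omega>\<in>space M. \<exists>j\<in>{m..n}. \<bar>X j \<omega> - X m \<omega>\<bar> \<ge> \<epsilon>} \<le>
    expectation (\<lambda>\<omega>. (X n \<omega>)\<^sup>2) - expectation (\<lambda>\<omega>. (X m \<omega>)\<^sup>2)"
proof -
  define D where "D k \<omega> = X k \<omega> - X m \<omega>" for k \<omega>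
  define b where "b k \<omega> = (of_bool (\<exists>j\<in>{m..k}. \<bar>D j \<omega>\<bar> \<ge> \<epsilon>) :: real)" for k \<omega>
  have [measurable]: "D k \<in> borel_measurable M" "b k \<in> borel_measurable M" for k
    unfolding D_def b_def by measurable
  have bd: "bounded (D k ` space M)" "bounded (b k ` space M)" for k
    unfolding D_def b_def by (intro bounded_comps bdd)+
  have int [simp]: "integrable M (b k)" "integrable M (\<lambda>\<omega>. D k \<omega> ^ 2 * b j \<omega>)"
      "integrable M (\<lambda>\<omega>. (D k \<omega>)\<^sup>2)" "integrable M (\<lambda>\<omega>. X k \<omega> * (D i \<omega> * b j \<omega>))" for i k j
    unfolding power2_eq_square by (intro integrable_of_bounded bounded_comps bd bdd; measurable)+
  have "\<epsilon>\<^sup>2 * expectation (b n) \<le> expectation (\<lambda>\<omega>. D n \<omega> ^ 2 * b n \<omega>)"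
    using assms(1)
  proof (induction n rule: dec_induct)
    case base
    then show ?case using \<epsilon> by (simp add: b_def D_def)
  next
    case (step k)
    \<comment> \<open>Testing the martingale property with \<open>D k * b k\<close> removes the cross term.\<close>
    let ?\<phi> = "\<lambda>h::nat \<Rightarrow> real. (h k - h m) * of_bool (\<exists>j\<in>{m..k}. \<bar>h j - h m\<bar> \<ge> \<epsilon>)"
    have \<phi>: "?\<phi> (\<lambda>j. X (min j k) \<omega>) = D k \<omega> * b k \<omega>" for \<omega>
      using step(1) unfolding b_def D_def by (auto simp: min.absorb1)
    have "?\<phi> \<in> borel_measurable borel" by measurable
    from mart[OF this, of k] have *: "expectation (\<lambda>\<omega>. X (Suc k) \<omega> * (D k \<omega> * b k \<omega>)) =
        expectation (\<lambda>\<omega>. X k \<omega> * (D k \<omega> * b k \<omega>))"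
      unfolding \<phi> by (simp add: bounded_comps bd)
    have pw: "D k \<omega> ^ 2 * b k \<omega> + 2 * (X (Suc k) \<omega> * (D k \<omega> * b k \<omega>) - X k \<omega> * (D k \<omega> * b k \<omega>))
        + \<epsilon>\<^sup>2 * (b (Suc k) \<omega> - b k \<omega>) \<le> D (Suc k) \<omega> ^ 2 * b (Suc k) \<omega>" for \<omega>
    proof (cases "b k \<omega> = 0")
      case True
      have "\<epsilon>\<^sup>2 * b (Suc k) \<omega> \<le> D (Suc k) \<omega> ^ 2 * b (Suc k) \<omega>"
      proof (cases "b (Suc k) \<omega> = 0")
        case False
        with True have "\<epsilon> \<le> \<bar>D (Suc k) \<omega>\<bar>" unfolding b_def
          by (auto simp: le_Suc_eq)
        then have "\<epsilon>\<^sup>2 \<le> D (Suc k) \<omega> ^ 2" using \<epsilon> by (metis abs_le_square_iff abs_of_pos)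
        then show ?thesis by (auto simp: b_def)
      qed simp
      with True show ?thesis by simp
    next
      case False
      then have "b k \<omega> = 1" "b (Suc k) \<omega> = 1"
        unfolding b_def by auto
      moreover have "D k \<omega> ^ 2 + 2 * (X (Suc k) \<omega> * D k \<omega> - X k \<omega> * D k \<omega>) \<le> D (Suc k) \<omega> ^ 2"
        using zero_le_power2[of "D (Suc k) \<omega> - D k \<omega>"] unfolding D_def
        by (simp add: power2_eq_square algebra_simps)
      ultimately show ?thesis by simp
    qed
    have "\<epsilon>\<^sup>2 * expectation (b k) + \<epsilon>\<^sup>2 * (expectation (b (Suc k)) - expectation (b k)) \<le>
      expectation (\<lambda>\<omega>. D k \<omega> ^ 2 * b k \<omega>) + 2 * (expectation (\<lambda>\<omega>. X (Suc k) \<omega> * (D k \<omega> * b k \<omega>))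
         - expectation (\<lambda>\<omega>. X k \<omega> * (D k \<omega> * b k \<omega>))) + \<epsilon>\<^sup>2 * (expectation (b (Suc k)) - expectation (b k))"
      using step.IH * by simp
    also have "\<dots> = expectation (\<lambda>\<omega>. D k \<omega> ^ 2 * b k \<omega> +
         2 * (X (Suc k) \<omega> * (D k \<omega> * b k \<omega>) - X k \<omega> * (D k \<omega> * b k \<omega>)) + \<epsilon>\<^sup>2 * (b (Suc k) \<omega> - b k \<omega>))"
      by simp
    also have "\<dots> \<le> expectation (\<lambda>\<omega>. D (Suc k) \<omega> ^ 2 * b (Suc k) \<omega>)"
      by (intro integral_mono pw) auto
    finally show ?case by (simp add: algebra_simps)
  qed
  also have "\<dots> \<le> expectation (\<lambda>\<omega>. (D n \<omega>)\<^sup>2)"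
    by (rule integral_mono[OF int(2) int(3)]) (auto simp: b_def)
  also have "\<dots> = expectation (\<lambda>\<omega>. (X n \<omega>)\<^sup>2) - expectation (\<lambda>\<omega>. (X m \<omega>)\<^sup>2)"
    unfolding D_def by (rule expectation_square_diff[OF assms(1)])
  also have "expectation (b n) = expectation (indicator {\<omega>\<in>space M. \<exists>j\<in>{m..n}. \<bar>X j \<omega> - X m \<omega>\<bar> \<ge> \<epsilon>})"
    by (intro Bochner_Integration.integral_cong) (auto simp: b_def D_def indicator_def)
  also have "\<dots> = prob {\<omega>\<in>space M. \<exists>j\<in>{m..n}. \<bar>X j \<omega> - X m \<omega>\<bar> \<ge> \<epsilon>}"
    by simp
  finally show ?thesis .
qed

lemma square_limit:
  assumes "\<And>n. expectation (\<lambda>\<omega>. (X n \<omega>)\<^sup>2) \<le> K"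
  obtains L where "(\<lambda>n. expectation (\<lambda>\<omega>. (X n \<omega>)\<^sup>2)) \<longlonglongrightarrow> L"
    "\<And>n. expectation (\<lambda>\<omega>. (X n \<omega>)\<^sup>2) \<le> L"
  using incseq_convergent[of "\<lambda>n. expectation (\<lambda>\<omega>. (X n \<omega>)\<^sup>2)"]
    expectation_square_mono assms by (auto simp: incseq_def)

text \<open>The maximal inequality bounds the probability that the path ever moves by \<open>\<epsilon>\<close> after time \<open>m\<close> by
  the remaining growth of the second moment, which tends to \<open>0\<close>. Hence almost every path is
  a Cauchy sequence.\<close>

lemma AE_convergent:
  assumes K: "\<And>n. expectation (\<lambda>\<omega>. (X n \<omega>)\<^sup>2) \<le> K"
  shows "AE \<omega> in M. convergent (\<lambda>n. X n \<omega>)"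
proof -
  obtain L where L: "(\<lambda>n. expectation (\<lambda>\<omega>. (X n \<omega>)\<^sup>2)) \<longlonglongrightarrow> L"
    "\<And>n. expectation (\<lambda>\<omega>. (X n \<omega>)\<^sup>2) \<le> L"
    using square_limit[OF K] by auto
  have tail: "\<epsilon>\<^sup>2 * prob {\<omega>\<in>space M. \<exists>j\<ge>m. \<bar>X j \<omega> - X m \<omega>\<bar> \<ge> \<epsilon>} \<le>
      L - expectation (\<lambda>\<omega>. (X m \<omega>)\<^sup>2)" if \<epsilon>: "\<epsilon> > 0" for \<epsilon> :: real and m
  proof -
    let ?A = "\<lambda>n. {\<omega>\<in>space M. \<exists>j\<in>{m..n}. \<bar>X j \<omega> - X m \<omega>\<bar> \<ge> \<epsilon>}"
    have un: "(\<Union>n. ?A n) = {\<omega>\<in>space M. \<exists>j\<ge>m. \<bar>X j \<omega> - X m \<omega>\<bar> \<ge> \<epsilon>}"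
      by auto (metis atLeastAtMost_iff le_refl)
    have "(\<lambda>n. \<epsilon>\<^sup>2 * prob (?A n)) \<longlonglongrightarrow> \<epsilon>\<^sup>2 * prob (\<Union>n. ?A n)"
    proof (intro tendsto_mult tendsto_const finite_Lim_measure_incseq)
      show "incseq ?A"
      proof (rule monoI)
        fix n n' :: nat assume "n \<le> n'"
        then have "{m..n} \<subseteq> {m..n'}" by auto
        then show "?A n \<subseteq> ?A n'" by blast
      qed
      have "?A n \<in> sets M" for n by measurable
      then show "range ?A \<subseteq> sets M" by blast
    qed
    moreover have "\<forall>\<^sub>F n in sequentially. \<epsilon>\<^sup>2 * prob (?A n) \<le> L - expectation (\<lambda>\<omega>. (X m \<omega>)\<^sup>2)"
      using eventually_ge_at_top[of m]
    proof eventually_elim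
      case (elim n)
      from maximal_inequality[OF elim \<epsilon>] L(2)[of n] show ?case by linarith
    qed
    ultimately show ?thesis unfolding un
      by (intro tendsto_upperbound[of _ _ sequentially]) auto
  qed
  have "AE \<omega> in M. \<exists>m. \<forall>j\<ge>m. \<bar>X j \<omega> - X m \<omega>\<bar> < 1 / real (Suc i)" for i
  proof -
    define \<epsilon> where "\<epsilon> = 1 / real (Suc i)"
    have \<epsilon>: "\<epsilon> > 0" unfolding \<epsilon>_def by simp
    let ?N = "{\<omega>\<in>space M. \<forall>m. \<exists>j\<ge>m. \<bar>X j \<omega> - X m \<omega>\<bar> \<ge> \<epsilon>}"
    have "\<epsilon>\<^sup>2 * prob ?N \<le> L - expectation (\<lambda>\<omega>. (X m \<omega>)\<^sup>2)" for m
    proof -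
      have "prob ?N \<le> prob {\<omega>\<in>space M. \<exists>j\<ge>m. \<bar>X j \<omega> - X m \<omega>\<bar> \<ge> \<epsilon>}"
        by (intro finite_measure_mono) auto
      then have "\<epsilon>\<^sup>2 * prob ?N \<le> \<epsilon>\<^sup>2 * prob {\<omega>\<in>space M. \<exists>j\<ge>m. \<bar>X j \<omega> - X m \<omega>\<bar> \<ge> \<epsilon>}"
        by (intro mult_left_mono) auto
      with tail[OF \<epsilon>, of m] show ?thesis by linarith
    qed
    moreover have "(\<lambda>m. L - expectation (\<lambda>\<omega>. (X m \<omega>)\<^sup>2)) \<longlonglongrightarrow> L - L"
      by (intro tendsto_intros L)
    ultimately have "\<epsilon>\<^sup>2 * prob ?N \<le> 0"
      by (intro tendsto_lowerbound[of _ "0::real" sequentially]) auto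
    then have "prob ?N = 0" using \<epsilon> by (simp add: mult_le_0_iff measure_le_0_iff)
    then have "AE \<omega> in M. \<not> (\<forall>m. \<exists>j\<ge>m. \<bar>X j \<omega> - X m \<omega>\<bar> \<ge> \<epsilon>)"
      by (subst prob_Collect_eq_0[symmetric]) auto
    then show ?thesis unfolding \<epsilon>_def by eventually_elim (metis not_le)
  qed
  then have "AE \<omega> in M. \<forall>i. \<exists>m. \<forall>j\<ge>m. \<bar>X j \<omega> - X m \<omega>\<bar> < 1 / real (Suc i)"
    by (subst AE_all_countable) auto
  then show ?thesis
  proof eventually_elim
    case (elim \<omega>)
    have "Cauchy (\<lambda>n. X n \<omega>)"
      unfolding Cauchy_altdef2
    proof (intro allI impI)
      fix e :: real assume "e > 0"
      then obtain i where i: "1 / real (Suc i) < e" by (metis nat_approx_posE)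
      with elim obtain m where "\<forall>j\<ge>m. \<bar>X j \<omega> - X m \<omega>\<bar> < 1 / real (Suc i)" by blast
      with i show "\<exists>N. \<forall>n\<ge>N. dist (X n \<omega>) (X N \<omega>) < e"
        by (intro exI[of _ m]) (auto simp: dist_real_def intro: less_trans)
    qed
    then show ?case by (simp add: Cauchy_convergent_iff)
  qed
qed

text \<open>Fatou's lemma turns almost sure convergence into
  \<open>E[(Y - X n)\<^sup>2] \<le> L - E[(X n)\<^sup>2]\<close>, where \<open>L\<close> is the limit of the second moments; so the
  convergence also holds in mean square, and first and second moments pass to the limit. The
  latter is done with the elementary bounds \<open>\<bar>y\<bar> \<le> \<delta> + y\<^sup>2 / \<delta>\<close> and
  \<open>\<bar>y\<^sup>2 - x\<^sup>2\<bar> \<le> \<delta> y\<^sup>2 + (1 + 1 / \<delta>) (y - x)\<^sup>2\<close>.\<close>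

lemma limit_moments:
  assumes K: "\<And>n. expectation (\<lambda>\<omega>. (X n \<omega>)\<^sup>2) \<le> K"
    and [measurable]: "Y \<in> borel_measurable M"
    and lim: "AE \<omega> in M. (\<lambda>n. X n \<omega>) \<longlonglongrightarrow> Y \<omega>"
  shows limit_integrable_square: "integrable M (\<lambda>\<omega>. (Y \<omega>)\<^sup>2)"
    and limit_integrable: "integrable M Y"
    and limit_expectation: "expectation Y = expectation (X 0)"
    and limit_expectation_square: "(\<lambda>n. expectation (\<lambda>\<omega>. (X n \<omega>)\<^sup>2)) \<longlonglongrightarrow> expectation (\<lambda>\<omega>. (Y \<omega>)\<^sup>2)"
proof -
  let ?a = "\<lambda>n. expectation (\<lambda>\<omega>. (X n \<omega>)\<^sup>2)"
  obtain L where L: "?a \<longlonglongrightarrow> L" "\<And>n. ?a n \<le> L"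
    using square_limit[OF K] by auto
  have intX2 [simp]: "integrable M (\<lambda>\<omega>. (X n \<omega>)\<^sup>2)" and intD2 [simp]: "integrable M (\<lambda>\<omega>. (X N \<omega> - X n \<omega>)\<^sup>2)"
    and intX [simp]: "integrable M (X n)" for n N
    unfolding power2_eq_square by (intro integrable_of_bounded bounded_comps bdd; measurable)+
  have nn: "(\<integral>\<^sup>+\<omega>. ennreal ((Y \<omega> - X n \<omega>)\<^sup>2) \<partial>M) \<le> ennreal (L - ?a n)" for n
  proof -
    have "(\<integral>\<^sup>+\<omega>. ennreal ((Y \<omega> - X n \<omega>)\<^sup>2) \<partial>M) = (\<integral>\<^sup>+\<omega>. liminf (\<lambda>N. ennreal ((X N \<omega> - X n \<omega>)\<^sup>2)) \<partial>M)"
    proof (rule nn_integral_cong_AE)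
      show "AE \<omega> in M. ennreal ((Y \<omega> - X n \<omega>)\<^sup>2) = liminf (\<lambda>N. ennreal ((X N \<omega> - X n \<omega>)\<^sup>2))"
        using lim
      proof eventually_elim
        case (elim \<omega>)
        then have "(\<lambda>N. ennreal ((X N \<omega> - X n \<omega>)\<^sup>2)) \<longlonglongrightarrow> ennreal ((Y \<omega> - X n \<omega>)\<^sup>2)"
          by (intro tendsto_ennrealI tendsto_intros)
        then show ?case by (rule lim_imp_Liminf[OF sequentially_bot, symmetric])
      qed
    qed
    also have "\<dots> \<le> liminf (\<lambda>N. \<integral>\<^sup>+\<omega>. ennreal ((X N \<omega> - X n \<omega>)\<^sup>2) \<partial>M)"
      by (intro nn_integral_liminf) measurable
    also have "\<dots> \<le> ennreal (L - ?a n)"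
    proof -
      have "\<forall>\<^sub>F N in sequentially. (\<integral>\<^sup>+\<omega>. ennreal ((X N \<omega> - X n \<omega>)\<^sup>2) \<partial>M) \<le> ennreal (L - ?a n)"
        using eventually_ge_at_top[of n]
      proof eventually_elim
        case (elim N)
        have "(\<integral>\<^sup>+\<omega>. ennreal ((X N \<omega> - X n \<omega>)\<^sup>2) \<partial>M) = ennreal (expectation (\<lambda>\<omega>. (X N \<omega> - X n \<omega>)\<^sup>2))"
          by (intro nn_integral_eq_integral) auto
        then show ?case using expectation_square_diff[OF elim] L(2)[of N] by (auto intro!: ennreal_leI)
      qed
      from Liminf_mono[OF this] show ?thesis by (simp add: Liminf_const)
    qed
    finally show ?thesis .
  qed
  have intYD [simp]: "integrable M (\<lambda>\<omega>. (Y \<omega> - X n \<omega>)\<^sup>2)" for n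
    by (rule integrableI_bounded) (use nn[of n] in \<open>auto simp: less_top[symmetric] top_unique\<close>)
  have D: "expectation (\<lambda>\<omega>. (Y \<omega> - X n \<omega>)\<^sup>2) \<le> L - ?a n" for n
  proof -
    have "ennreal (expectation (\<lambda>\<omega>. (Y \<omega> - X n \<omega>)\<^sup>2)) \<le> ennreal (L - ?a n)"
      using nn[of n] by (subst nn_integral_eq_integral[symmetric]) auto
    then show ?thesis using L(2)[of n] by (simp add: ennreal_le_iff)
  qed
  show intY2: "integrable M (\<lambda>\<omega>. (Y \<omega>)\<^sup>2)"
  proof (rule Bochner_Integration.integrable_bound)
    show "integrable M (\<lambda>\<omega>. 2 * (Y \<omega> - X 0 \<omega>)\<^sup>2 + 2 * (X 0 \<omega>)\<^sup>2)" by simp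
    have "y\<^sup>2 \<le> 2 * (y - x)\<^sup>2 + 2 * x\<^sup>2" for x y :: real
      using zero_le_power2[of "y - 2 * x"] by (simp add: power2_eq_square algebra_simps)
    then show "AE \<omega> in M. norm ((Y \<omega>)\<^sup>2) \<le> norm (2 * (Y \<omega> - X 0 \<omega>)\<^sup>2 + 2 * (X 0 \<omega>)\<^sup>2)"
      by (auto simp: abs_of_nonneg)
  qed measurable
  show intY: "integrable M Y"
    using square_integrable_imp_integrable[OF _ intY2] by simp
  have Llim: "(\<lambda>n. L - ?a n) \<longlonglongrightarrow> 0"
    using tendsto_diff[OF tendsto_const L(1), of L] by simp
  have small: "\<bar>y\<bar> \<le> \<delta> + y\<^sup>2 / \<delta>" if "\<delta> > 0" for y \<delta> :: real
  proof (cases "\<bar>y\<bar> \<le> \<delta>")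
    case False
    then have "\<bar>y\<bar> * \<delta> \<le> \<bar>y\<bar> * \<bar>y\<bar>" using that by (intro mult_left_mono) auto
    then have "\<bar>y\<bar> \<le> y\<^sup>2 / \<delta>" using that by (simp add: field_simps power2_eq_square)
    then show ?thesis using that by simp
  next
    case True
    then show ?thesis using that by (smt (verit) divide_nonneg_pos zero_le_power2)
  qed
  show "expectation Y = expectation (X 0)"
  proof -
    have "\<bar>expectation Y - expectation (X 0)\<bar> \<le> 0 + \<delta>" if \<delta>: "\<delta> > 0" for \<delta>
    proof -
      have "\<bar>expectation Y - expectation (X 0)\<bar> \<le> \<delta> + (L - ?a n) / \<delta>" for n
      proof -
        have "\<bar>expectation Y - expectation (X 0)\<bar> = \<bar>expectation (\<lambda>\<omega>. Y \<omega> - X n \<omega>)\<bar>"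
          using expectation_X[of n] intY by simp
        also have "\<dots> \<le> expectation (\<lambda>\<omega>. \<bar>Y \<omega> - X n \<omega>\<bar>)" by (rule integral_abs_bound)
        also have "\<dots> \<le> expectation (\<lambda>\<omega>. \<delta> + (Y \<omega> - X n \<omega>)\<^sup>2 / \<delta>)"
          by (intro integral_mono small \<delta>) (use intY in auto)
        also have "\<dots> = \<delta> + expectation (\<lambda>\<omega>. (Y \<omega> - X n \<omega>)\<^sup>2) / \<delta>"
          by (simp add: prob_space)
        also have "\<dots> \<le> \<delta> + (L - ?a n) / \<delta>" using D[of n] \<delta> by (simp add: divide_right_mono)
        finally show ?thesis .
      qed
      moreover have "(\<lambda>n. \<delta> + (L - ?a n) / \<delta>) \<longlonglongrightarrow> \<delta> + 0 / \<delta>"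
        by (intro tendsto_intros Llim) (use \<delta> in auto)
      ultimately show ?thesis by (intro tendsto_lowerbound[of _ "0 + \<delta>" sequentially]) auto
    qed
    then have "\<bar>expectation Y - expectation (X 0)\<bar> \<le> 0" by (rule field_le_epsilon)
    then show ?thesis by simp
  qed
  have sq: "\<bar>y\<^sup>2 - x\<^sup>2\<bar> \<le> \<delta> * y\<^sup>2 + (1 + 1 / \<delta>) * (y - x)\<^sup>2" if "\<delta> > 0" for x y \<delta> :: real
  proof -
    have "0 \<le> (\<delta> * y - (y - x))\<^sup>2 / \<delta>" "0 \<le> (\<delta> * y + (y - x))\<^sup>2 / \<delta>" using that by auto
    then have "\<bar>2 * y * (y - x)\<bar> \<le> \<delta> * y\<^sup>2 + (y - x)\<^sup>2 / \<delta>"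
      using that by (simp add: power2_eq_square field_simps abs_le_iff)
    moreover have "y\<^sup>2 - x\<^sup>2 = 2 * y * (y - x) - (y - x)\<^sup>2" by (simp add: power2_eq_square algebra_simps)
    ultimately have "\<bar>y\<^sup>2 - x\<^sup>2\<bar> \<le> \<delta> * y\<^sup>2 + (y - x)\<^sup>2 / \<delta> + (y - x)\<^sup>2"
      using zero_le_power2[of "y - x"] by linarith
    then show ?thesis by (simp add: algebra_simps)
  qed
  let ?b = "expectation (\<lambda>\<omega>. (Y \<omega>)\<^sup>2)"
  have "\<bar>?b - L\<bar> \<le> 0 + \<epsilon>" if \<epsilon>: "\<epsilon> > 0" for \<epsilon>
  proof -
    \<comment> \<open>With this choice \<open>\<delta> * ?b \<le> \<epsilon>\<close>; the summand \<open>1\<close> avoids a division by zero.\<close>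
    define \<delta> where "\<delta> = \<epsilon> / (1 + ?b)"
    have b0: "0 \<le> ?b" by simp
    have \<delta>: "\<delta> > 0" unfolding \<delta>_def using \<epsilon> b0 by (intro divide_pos_pos) linarith+
    have "\<bar>?b - ?a n\<bar> \<le> \<delta> * ?b + (1 + 1 / \<delta>) * (L - ?a n)" for n
    proof -
      have "\<bar>?b - ?a n\<bar> = \<bar>expectation (\<lambda>\<omega>. (Y \<omega>)\<^sup>2 - (X n \<omega>)\<^sup>2)\<bar>"
        using intY2 by simp
      also have "\<dots> \<le> expectation (\<lambda>\<omega>. \<bar>(Y \<omega>)\<^sup>2 - (X n \<omega>)\<^sup>2\<bar>)" by (rule integral_abs_bound)
      also have "\<dots> \<le> expectation (\<lambda>\<omega>. \<delta> * (Y \<omega>)\<^sup>2 + (1 + 1 / \<delta>) * (Y \<omega> - X n \<omega>)\<^sup>2)"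
        by (intro integral_mono sq \<delta>) (use intY2 in auto)
      also have "\<dots> = \<delta> * ?b + (1 + 1 / \<delta>) * expectation (\<lambda>\<omega>. (Y \<omega> - X n \<omega>)\<^sup>2)"
        using intY2 by simp
      also have "\<dots> \<le> \<delta> * ?b + (1 + 1 / \<delta>) * (L - ?a n)"
        using \<delta> by (intro add_left_mono mult_left_mono D) auto
      finally show ?thesis .
    qed
    moreover have "(\<lambda>n. \<delta> * ?b + (1 + 1 / \<delta>) * (L - ?a n)) \<longlonglongrightarrow> \<delta> * ?b + (1 + 1 / \<delta>) * 0"
      by (intro tendsto_intros Llim)
    moreover have "(\<lambda>n. \<bar>?b - ?a n\<bar>) \<longlonglongrightarrow> \<bar>?b - L\<bar>" by (intro tendsto_intros L)
    ultimately have "\<bar>?b - L\<bar> \<le> \<delta> * ?b"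
      by (intro LIMSEQ_le[of _ _ _ "\<delta> * ?b"]) auto
    also have "\<dots> \<le> \<delta> * (1 + ?b)" using \<delta> by simp
    also have "\<dots> = \<epsilon>"
    proof -
      have "1 + ?b \<noteq> 0" using b0 by linarith
      then show ?thesis unfolding \<delta>_def by simp
    qed
    finally show ?thesis by simp
  qed
  then have "\<bar>?b - L\<bar> \<le> 0" by (rule field_le_epsilon)
  then show "?a \<longlonglongrightarrow> ?b" using L(1) by simp
qed

end

section \<open>Fourier analysis on the torus\<close>

lemma real_vec_add: "real_vec (x + y) = real_vec x + real_vec y"
  and real_vec_diff: "real_vec (x - y) = real_vec x - real_vec y"
  and real_vec_0: "real_vec 0 = 0"
  and real_vec_eq_0_iff: "real_vec x = 0 \<longleftrightarrow> x = 0"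
  by (auto simp: real_vec_def vec_eq_iff)

lemma cis_measurable [measurable]: "cis \<in> borel_measurable borel"
  by (intro borel_measurable_continuous_onI continuous_intros)

text \<open>The half-open interval matches the definition of the torus; the fundamental theorem of calculus
  applies to the closed interval, which differs from it by one point.\<close>

lemma integral_cis_interval:
  fixes k :: int
  shows "integrable lborel (\<lambda>t::real. indicator {- pi<..pi} t *\<^sub>R cis (t * of_int k))"
    and "(\<integral>t. indicator {- pi<..pi} t *\<^sub>R cis (t * of_int k) \<partial>lborel) =
      complex_of_real (if k = 0 then 2 * pi else 0)"
proof -
  let ?f = "\<lambda>t::real. cis (t * of_int k)"
  define F where "F t = (if k = 0 then of_real t else cis (t * of_int k) / (\<i> * of_int k))" for t :: real
  have F: "(F has_vector_derivative ?f t) (at t within S)" for t S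
  proof (cases "k = 0")
    case True
    then show ?thesis unfolding F_def by (auto intro!: derivative_eq_intros)
  next
    case False
    have "((\<lambda>z. exp (\<i> * z * of_int k) / (\<i> * of_int k)) has_field_derivative
        exp (\<i> * of_real t * of_int k)) (at (of_real t))"
      using False by (auto intro!: derivative_eq_intros)
    from has_vector_derivative_real_field[OF this]
    show ?thesis using False unfolding F_def by (simp add: cis_conv_exp mult.assoc)
  qed
  have cont: "continuous_on {- pi..pi} ?f" by (intro continuous_intros)
  have "has_bochner_integral lborel (\<lambda>t. indicator {- pi..pi} t *\<^sub>R ?f t) (F pi - F (- pi))"
    by (rule has_bochner_integral_FTC_Icc[OF _ F cont]) simp
  moreover have "F pi - F (- pi) = of_real (if k = 0 then 2 * pi else 0)"
  proof (cases "k = 0")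
    case False
    have "sin (pi * of_int k) = 0" by (rule sin_npi_int)
    then have "cis (pi * of_int k) = cis (- pi * of_int k)"
      by (simp add: complex_eq_iff)
    with False show ?thesis unfolding F_def by (simp only: if_False diff_self of_real_0)
  qed (simp add: F_def)
  ultimately have closed: "has_bochner_integral lborel (\<lambda>t. indicator {- pi..pi} t *\<^sub>R ?f t)
      (of_real (if k = 0 then 2 * pi else 0))" by simp
  have ae: "AE t in lborel. indicator {- pi..pi} t *\<^sub>R ?f t = indicator {- pi<..pi} t *\<^sub>R ?f t"
    using AE_lborel_singleton[of "- pi"] by eventually_elim (auto simp: indicator_def)
  have m: "(\<lambda>t. indicator {- pi..pi} t *\<^sub>R ?f t) \<in> borel_measurable lborel"
      "(\<lambda>t. indicator {- pi<..pi} t *\<^sub>R ?f t) \<in> borel_measurable lborel"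
    by measurable
  have half_open: "has_bochner_integral lborel (\<lambda>t. indicator {- pi<..pi} t *\<^sub>R ?f t)
      (of_real (if k = 0 then 2 * pi else 0))"
    using closed unfolding has_bochner_integral_cong_AE[OF m ae] .
  show "integrable lborel (\<lambda>t::real. indicator {- pi<..pi} t *\<^sub>R ?f t)"
    by (rule integrable.intros[OF half_open])
  show "(\<integral>t. indicator {- pi<..pi} t *\<^sub>R ?f t \<partial>lborel) = complex_of_real (if k = 0 then 2 * pi else 0)"
    by (rule has_bochner_integral_integral_eq[OF half_open])
qed

lemma torus_Basis: "torus = {\<theta> :: real ^ 'd::finite. \<forall>b\<in>Basis. \<theta> \<bullet> b \<in> {- pi<..pi}}"
  by (auto simp: torus_def Basis_vec_def inner_axis)

lemma torus_measurable [measurable]: "(torus :: (real ^ 'd::finite) set) \<in> sets borel"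
proof -
  have "torus = {\<theta> \<in> space (borel :: (real ^ 'd) measure). \<forall>b\<in>Basis. \<theta> \<bullet> b \<in> {- pi<..pi}}"
    by (simp add: torus_Basis)
  also have "\<dots> \<in> sets borel" by measurable
  finally show ?thesis .
qed

text \<open>Lebesgue measure on the coordinate space is a product measure, and both the indicator of the
  torus and the exponential factor over the coordinates.\<close>

lemma integral_cis_torus:
  fixes z :: "int ^ 'd::finite"
  shows "(\<integral>\<theta>. indicator torus \<theta> *\<^sub>R cis (\<theta> \<bullet> real_vec z) \<partial>lborel) =
    (if z = 0 then (2 * pi) ^ CARD('d) else 0)"
proof -
  \<comment> \<open>The coordinate of \<open>z\<close> belonging to a vector of the standard basis.\<close>
  define k where "k b = z $ (SOME i. b = axis i (1::real))" for b :: "real ^ 'd"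
  have k_axis: "k (axis i 1) = z $ i" for i
  proof -
    have "(SOME j. axis i (1::real) = axis j 1) = i" by (rule some_equality) (auto simp: axis_eq_axis)
    then show ?thesis by (simp add: k_def)
  qed
  have k: "real_vec z \<bullet> b = of_int (k b)" if "b \<in> Basis" for b
    using that by (auto simp: Basis_vec_def k_axis real_vec_def inner_axis)
  let ?g = "\<lambda>b t. indicator {- pi<..pi} t *\<^sub>R cis (t * of_int (k b))"
  interpret product_sigma_finite "\<lambda>b :: real ^ 'd. lborel :: real measure" ..
  have meas: "(\<lambda>\<theta> :: real ^ 'd. indicator torus \<theta> *\<^sub>R cis (\<theta> \<bullet> real_vec z)) \<in> borel_measurable borel"
    by measurable
  have meas2: "(\<lambda>f. \<Sum>b\<in>Basis. f b *\<^sub>R b) \<in> measurable (Pi\<^sub>M Basis (\<lambda>_. lborel)) (borel :: (real ^ 'd) measure)"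
    by measurable
  have pw: "indicator torus (\<Sum>b\<in>Basis. f b *\<^sub>R b) *\<^sub>R cis ((\<Sum>b\<in>Basis. f b *\<^sub>R b) \<bullet> real_vec z) =
      (\<Prod>b\<in>Basis. ?g b (f b))" for f :: "real ^ 'd \<Rightarrow> real"
  proof -
    let ?\<theta> = "\<Sum>b\<in>Basis. f b *\<^sub>R b :: real ^ 'd"
    have coord: "?\<theta> \<bullet> b = f b" if "b \<in> Basis" for b using that by simp
    have "?\<theta> \<bullet> real_vec z = (\<Sum>b\<in>Basis. f b * (b \<bullet> real_vec z))"
      by (simp only: inner_sum_left inner_scaleR_left)
    also have "\<dots> = (\<Sum>b\<in>Basis. f b * of_int (k b))"
      by (intro sum.cong refl) (simp add: k[symmetric] inner_commute)
    finally have "?\<theta> \<bullet> real_vec z = (\<Sum>b\<in>Basis. f b * of_int (k b))" .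
    then have "cis (?\<theta> \<bullet> real_vec z) = (\<Prod>b\<in>Basis. cis (f b * of_int (k b)))"
      by (simp add: cis_conv_exp sum_distrib_left exp_sum)
    moreover have "indicator torus ?\<theta> = (\<Prod>b\<in>Basis. indicator {- pi<..pi} (f b) :: real)"
    proof (cases "?\<theta> \<in> torus")
      case True
      then have "f b \<in> {- pi<..pi}" if "b \<in> Basis" for b
        using that coord unfolding torus_Basis by fastforce
      then show ?thesis using True by (simp add: prod.neutral)
    next
      case False
      then obtain b :: "real ^ 'd" where b: "b \<in> Basis" "f b \<notin> {- pi<..pi}"
        using coord unfolding torus_Basis by fastforce
      have "(\<Prod>b\<in>Basis. indicator {- pi<..pi} (f b) :: real) = 0"
        by (rule prod_zero[OF finite_Basis bexI[OF _ b(1)]]) (use b(2) in simp)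
      then show ?thesis using False by simp
    qed
    ultimately show ?thesis by (simp add: scaleR_conv_of_real prod.distrib)
  qed
  have "(\<integral>\<theta>. indicator torus \<theta> *\<^sub>R cis (\<theta> \<bullet> real_vec z) \<partial>lborel) =
      (\<integral>f. (\<Prod>b\<in>Basis. ?g b (f b)) \<partial>Pi\<^sub>M Basis (\<lambda>_. lborel))"
    unfolding lborel_eq[where 'a = "real ^ 'd"] integral_distr[OF meas2 meas] pw ..
  also have "\<dots> = (\<Prod>b\<in>Basis. \<integral>t. ?g b t \<partial>lborel)"
    by (rule product_integral_prod) (auto intro: integral_cis_interval)
  also have "\<dots> = (\<Prod>b\<in>Basis. of_real (if k b = 0 then 2 * pi else 0))"
    by (simp add: integral_cis_interval)
  also have "\<dots> = (if z = 0 then (2 * pi) ^ CARD('d) else 0)"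
  proof (cases "z = 0")
    case True
    then show ?thesis by (simp add: k_def)
  next
    case False
    then obtain i where "z $ i \<noteq> 0" by (auto simp: vec_eq_iff)
    then have "\<exists>b\<in>Basis :: (real ^ 'd) set. k b \<noteq> 0"
      by (intro bexI[of _ "axis i 1"]) (auto simp: k_axis)
    then have "(\<Prod>b\<in>Basis. complex_of_real (if k b = 0 then 2 * pi else 0)) = 0"
      by (intro prod_zero) auto
    with False show ?thesis by simp
  qed
  finally show ?thesis .
qed

text \<open>The volume is the trivial Fourier coefficient of the indicator. The real-valued measure
  of a set is \<open>0\<close> if its volume is infinite, so a nonzero value already shows that the volume is finite.\<close>

lemma emeasure_torus: "emeasure lborel (torus :: (real ^ 'd::finite) set) = ennreal ((2 * pi) ^ CARD('d))"
proof -
  let ?T = "torus :: (real ^ 'd) set"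
  have zero: "cis (\<theta> \<bullet> real_vec (0 :: int ^ 'd)) = 1" for \<theta>
    by (simp add: real_vec_0)
  have "complex_of_real (\<integral>\<theta>. indicator ?T \<theta> \<partial>lborel) = (\<integral>\<theta>. indicator ?T \<theta> *\<^sub>R cis (\<theta> \<bullet> real_vec 0) \<partial>lborel)"
    unfolding zero scaleR_conv_of_real mult_1_right by (rule integral_complex_of_real[symmetric])
  also have "\<dots> = of_real ((2 * pi) ^ CARD('d))"
    by (subst integral_cis_torus) simp
  finally have "(\<integral>\<theta>. indicator ?T \<theta> \<partial>lborel) = (2 * pi) ^ CARD('d)"
    by (simp only: of_real_eq_iff)
  then have m: "measure lborel ?T = (2 * pi) ^ CARD('d)" by simp
  have "emeasure lborel ?T \<noteq> top"
  proof
    assume "emeasure lborel ?T = top"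
    then have "measure lborel ?T = 0" by (simp only: measure_def enn2real_top)
    with m show False by simp
  qed
  then have "emeasure lborel ?T = ennreal (measure lborel ?T)" by (rule emeasure_eq_ennreal_measure)
  then show ?thesis by (simp only: m)
qed

definition torus_measure :: "(real ^ 'd::finite) measure" where
  "torus_measure = uniform_measure lborel torus"

lemma sets_torus_measure [simp, measurable_cong]: "sets torus_measure = sets borel"
  by (simp add: torus_measure_def)

lemma prob_space_torus_measure: "prob_space (torus_measure :: (real ^ 'd::finite) measure)"
  unfolding torus_measure_def
  by (rule prob_space_uniform_measure) (simp_all add: emeasure_torus)

interpretation torus: prob_space "torus_measure :: (real ^ 'd::finite) measure"
  by (rule prob_space_torus_measure)

lemma integrable_torus_measure_bounded:
  fixes f :: "real ^ 'd::finite \<Rightarrow> 'b::{banach, second_countable_topology}"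
  assumes "f \<in> borel_measurable borel" "\<And>\<theta>. norm (f \<theta>) \<le> C"
  shows "integrable torus_measure f"
  by (rule torus.integrable_const_bound[of _ C]) (use assms in auto)

lemma integral_torus_measure:
  fixes f :: "real ^ 'd::finite \<Rightarrow> 'b::{banach, second_countable_topology}"
  assumes [measurable]: "f \<in> borel_measurable borel"
  shows "(\<integral>\<theta>. f \<theta> \<partial>torus_measure) = (1 / (2 * pi) ^ CARD('d)) *\<^sub>R (LINT \<theta>:torus|lborel. f \<theta>)"
proof -
  have "indicator torus \<theta> / ennreal ((2 * pi) ^ CARD('d)) = ennreal (indicator torus \<theta> / (2 * pi) ^ CARD('d))"
    for \<theta> :: "real ^ 'd"
    unfolding ennreal_indicator[symmetric] by (rule divide_ennreal) simp_all
  then have eq: "torus_measure = density lborel (\<lambda>\<theta> :: real ^ 'd. ennreal (indicator torus \<theta> / (2 * pi) ^ CARD('d)))"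
    unfolding torus_measure_def uniform_measure_def emeasure_torus by (simp only:)
  have "(\<integral>\<theta>. f \<theta> \<partial>torus_measure) =
      (\<integral>\<theta>. (indicator torus \<theta> / (2 * pi) ^ CARD('d)) *\<^sub>R f \<theta> \<partial>lborel)"
    unfolding eq by (rule integral_density) auto
  also have "\<dots> = (\<integral>\<theta>. (1 / (2 * pi) ^ CARD('d)) *\<^sub>R (indicator torus \<theta> *\<^sub>R f \<theta>) \<partial>lborel)"
    by simp
  finally show ?thesis by (simp only: set_lebesgue_integral_def integral_scaleR_right)
qed

lemma AE_torus_measure: "(AE \<theta> in lborel. Q \<theta>) \<Longrightarrow> AE \<theta> in torus_measure. Q \<theta>"
  unfolding torus_measure_def by (rule AE_uniform_measureI) auto

lemma fourier_orthogonality: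
  "(\<integral>\<theta>. cis (\<theta> \<bullet> real_vec z) \<partial>torus_measure) = (if z = 0 then 1 else 0)"
proof -
  have meas: "(\<lambda>\<theta>. cis (\<theta> \<bullet> real_vec z)) \<in> borel_measurable borel" by measurable
  show ?thesis
    unfolding integral_torus_measure[OF meas] set_lebesgue_integral_def integral_cis_torus
    by (simp add: scaleR_conv_of_real)
qed

text \<open>The exceptional set is a countable union of hyperplanes \<open>\<theta> \<bullet> w = 2 \<pi> k\<close>.\<close>

lemma AE_cos_less_1:
  fixes w :: "int ^ 'd::finite"
  assumes "w \<noteq> 0"
  shows "AE \<theta> in torus_measure. cos (\<theta> \<bullet> real_vec w) < 1"
proof (rule AE_torus_measure)
  have "AE \<theta> in lborel. \<theta> \<bullet> real_vec w \<noteq> of_int k * 2 * pi" for k :: int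
  proof (rule AE_I')
    let ?N = "{\<theta>. real_vec w \<bullet> \<theta> = of_int k * 2 * pi}"
    have "negligible ?N"
      using assms by (intro negligible_hyperplane) (simp add: real_vec_eq_0_iff)
    then have "?N \<in> null_sets lebesgue" by (simp add: negligible_iff_null_sets)
    moreover have "?N \<in> sets lborel" by (simp add: closed_hyperplane)
    ultimately show "?N \<in> null_sets lborel" by (simp add: null_sets_completion_iff)
    show "{\<theta> \<in> space lborel. \<not> \<theta> \<bullet> real_vec w \<noteq> of_int k * 2 * pi} \<subseteq> ?N"
      by (auto simp: inner_commute)
  qed
  then have "AE \<theta> in lborel. \<forall>k::int. \<theta> \<bullet> real_vec w \<noteq> of_int k * 2 * pi"
    by (subst AE_all_countable) auto
  then show "AE \<theta> in lborel. cos (\<theta> \<bullet> real_vec w) < 1"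
  proof eventually_elim
    case (elim \<theta>)
    then have "cos (\<theta> \<bullet> real_vec w) \<noteq> 1" by (auto simp: cos_one_2pi_int)
    then show ?case using cos_le_one[of "\<theta> \<bullet> real_vec w"] by linarith
  qed
qed

section \<open>Mass arriving at a space-time point\<close>

text \<open>The mass found at \<open>x\<close> at time \<open>t\<close> when every site carries unit mass at time \<open>t - N\<close>; this is the
  \<open>N\<close>-th density approximation seen from \<open>(x, t)\<close>. Conditioning on the last jump \<open>u \<in> J\<close> gives a
  recursion that never leaves finite sums, so measurability and boundedness are immediate. The space-time
  point is a parameter because the recursion moves it.\<close>

primrec arriving_mass :: "(int ^ 'd) set \<Rightarrow> nat \<Rightarrow> int ^ 'd \<Rightarrow> int \<Rightarrow> ('d::finite) env \<Rightarrow> real" where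
  "arriving_mass J 0 x t \<omega> = 1"
| "arriving_mass J (Suc N) x t \<omega> =
     (\<Sum>u\<in>J. \<omega> (x - u, t - 1) u * arriving_mass J N (x - u) (t - 1) \<omega>)"

lemma env_coordinate_measurable [measurable]:
  "(\<lambda>\<omega> :: ('d::finite) env. \<omega> i u) \<in> borel_measurable borel"
  by (rule measurable_compose[OF measurable_product_coordinates measurable_product_coordinates])

lemma arriving_mass_measurable [measurable]:
  "arriving_mass J N x t \<in> borel_measurable borel"
proof (induction N arbitrary: x t)
  case 0
  have "arriving_mass J 0 x t = (\<lambda>\<omega>. 1)" by auto
  then show ?case by simp
next
  case (Suc N)
  note [measurable] = Suc
  have "arriving_mass J (Suc N) x t =
      (\<lambda>\<omega>. \<Sum>u\<in>J. \<omega> (x - u, t - 1) u * arriving_mass J N (x - u) (t - 1) \<omega>)" by auto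
  then show ?case by simp
qed

lemma arriving_mass_cong:
  assumes "\<And>y s. t - int N \<le> s \<Longrightarrow> s < t \<Longrightarrow> \<omega> (y, s) = \<omega>' (y, s)"
  shows "arriving_mass J N x t \<omega> = arriving_mass J N x t \<omega>'"
  using assms
proof (induction N arbitrary: x t)
  case (Suc N)
  have "arriving_mass J N (x - u) (t - 1) \<omega> = arriving_mass J N (x - u) (t - 1) \<omega>'" for u
    by (rule Suc.IH) (auto intro!: Suc.prems)
  moreover have "\<omega> (x - u, t - 1) = \<omega>' (x - u, t - 1)" for u
    by (rule Suc.prems) auto
  ultimately show ?case by simp
qed simp

lemma arriving_mass_env_shift:
  "arriving_mass J N x t (env_shift y s \<omega>) = arriving_mass J N (y + x) (s + t) \<omega>"
  by (induction N arbitrary: x t) (simp_all add: env_shift_def algebra_simps)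

section \<open>Independence and the martingale property\<close>

locale iid_random_environment = prob_space P for P :: "('d::finite) env measure" +
  fixes R :: real
  assumes sets_P: "sets P = sets (env_space R)"
    and iid: "iid_environment P"
begin

definition jumps :: "(int ^ 'd) set" where
  "jumps = {z. norm (real_vec z) \<le> R}"

definition jump_moment :: "int ^ 'd \<Rightarrow> int ^ 'd \<Rightarrow> real" where
  "jump_moment u v = expectation (\<lambda>\<omega>. \<omega> (0, 0) u * \<omega> (0, 0) v)"

abbreviation mass :: "nat \<Rightarrow> int ^ 'd \<Rightarrow> int \<Rightarrow> 'd env \<Rightarrow> real" where
  "mass \<equiv> arriving_mass jumps"

lemma space_P: "space P = environments R"
  using sets_eq_imp_space_eq[OF sets_P] by (simp add: env_space_def space_restrict_space)

text \<open>The masses are finite expressions in the coordinates, hence measurable on the whole function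
  space; measurability on the space of environments is inherited from there.\<close>

lemma measurable_P: "f \<in> measurable borel N \<Longrightarrow> f \<in> measurable P N"
  using sets_P by (simp add: env_space_def measurable_restrict_space1 cong: measurable_cong_sets)

lemma jump_vector: "(\<omega> :: 'd env) \<in> environments R \<Longrightarrow> \<omega> i \<in> prob_vectors R"
  by (cases i) (auto simp: environments_def)

lemma jump_nonneg: "(q :: int ^ 'd \<Rightarrow> real) \<in> prob_vectors R \<Longrightarrow> 0 \<le> q z"
  and jump_outside: "(q :: int ^ 'd \<Rightarrow> real) \<in> prob_vectors R \<Longrightarrow> z \<notin> jumps \<Longrightarrow> q z = 0"
  and jump_sum: "(q :: int ^ 'd \<Rightarrow> real) \<in> prob_vectors R \<Longrightarrow> (\<Sum>z\<in>jumps. q z) = 1"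
  by (auto simp: prob_vectors_def jumps_def)

lemma finite_jumps: "finite jumps"
proof -
  obtain \<omega> :: "'d env" where "\<omega> \<in> environments R" using not_empty space_P by blast
  from jump_sum[OF jump_vector[OF this]] show ?thesis by (metis sum.infinite zero_neq_one)
qed

lemma jump_le_1:
  fixes q :: "int ^ 'd \<Rightarrow> real"
  assumes "q \<in> prob_vectors R"
  shows "q z \<le> 1"
proof (cases "z \<in> jumps")
  case True
  then show ?thesis
    using member_le_sum[of z jumps q] finite_jumps jump_sum[OF assms] jump_nonneg[OF assms] by simp
qed (use jump_outside[OF assms] in simp)

lemma bounded_jump: "bounded ((\<lambda>q :: int ^ 'd \<Rightarrow> real. q z) ` prob_vectors R)"
  unfolding bounded_real using jump_nonneg jump_le_1 by (auto intro!: exI[of _ 1])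

lemma bounded_env_coordinate: "bounded ((\<lambda>\<omega> :: 'd env. \<omega> i z) ` environments R)"
  by (rule bounded_subset[OF bounded_jump[of z]]) (auto intro: jump_vector)

lemma bounded_mass: "bounded (mass N x t ` environments R)"
proof (induction N arbitrary: x t)
  case 0
  show ?case using bounded_const_comp[of 1] by simp
next
  case (Suc N)
  have "bounded ((\<lambda>\<omega>. \<Sum>u\<in>jumps. \<omega> (x - u, t - 1) u * mass N (x - u) (t - 1) \<omega>) ` environments R)"
    by (intro bounded_comps bounded_env_coordinate Suc)
  then show ?case by simp
qed

lemma integrable_env:
  fixes f :: "'d env \<Rightarrow> real"
  assumes "f \<in> borel_measurable borel" "bounded (f ` environments R)"
  shows "integrable P f"
  by (intro integrable_of_bounded measurable_P assms) (simp add: space_P assms)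

lemma expectation_site:
  fixes \<phi> :: "(int ^ 'd \<Rightarrow> real) \<Rightarrow> real"
  assumes [measurable]: "\<phi> \<in> borel_measurable borel"
  shows "expectation (\<lambda>\<omega>. \<phi> (\<omega> i)) = expectation (\<lambda>\<omega>. \<phi> (\<omega> (0, 0)))"
proof -
  have c: "(\<lambda>\<omega>. \<omega> j) \<in> measurable P borel" for j :: "(int ^ 'd) \<times> int"
    by (intro measurable_P) measurable
  have "expectation (\<lambda>\<omega>. \<phi> (\<omega> j)) = (\<integral>q. \<phi> q \<partial>distr P borel (\<lambda>\<omega>. \<omega> j))" for j
    by (subst integral_distr[OF c]) auto
  moreover have "distr P borel (\<lambda>\<omega>. \<omega> i) = distr P borel (\<lambda>\<omega>. \<omega> (0, 0))"
    using iid unfolding iid_environment_def by blast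
  ultimately show ?thesis by simp
qed

text \<open>The only form in which independence enters: a function of the jump vector at one site is
  uncorrelated with every variable that does not look at this site.\<close>

lemma expectation_site_mult:
  fixes \<phi> :: "(int ^ 'd \<Rightarrow> real) \<Rightarrow> real"
  assumes \<phi> [measurable]: "\<phi> \<in> borel_measurable borel" and b\<phi>: "bounded (\<phi> ` prob_vectors R)"
    and Y [measurable]: "Y \<in> borel_measurable borel" and bY: "bounded (Y ` environments R)"
    and indep: "\<And>\<omega> \<omega>'. (\<And>j. j \<noteq> i \<Longrightarrow> \<omega> j = \<omega>' j) \<Longrightarrow> Y \<omega> = Y \<omega>'"
  shows "expectation (\<lambda>\<omega>. \<phi> (\<omega> i) * Y \<omega>) = expectation (\<lambda>\<omega>. \<phi> (\<omega> (0, 0))) * expectation Y"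
proof -
  let ?A = "- {i}"
  have iv: "indep_vars (\<lambda>_. borel) (\<lambda>i \<omega>. \<omega> i) UNIV"
    using iid unfolding iid_environment_def by (rule conjunct1)
  have ir: "indep_var (PiM {i} (\<lambda>_. borel)) (\<lambda>\<omega>. restrict \<omega> {i}) (PiM ?A (\<lambda>_. borel)) (\<lambda>\<omega>. restrict \<omega> ?A)"
    using indep_var_restrict[OF iv, of "{i}" ?A] by (metis Compl_disjoint subset_UNIV)
  let ?MA = "PiM ?A (\<lambda>_. borel) :: 'd env measure"
  \<comment> \<open>The restricted environment takes the value \<open>undefined\<close> at \<open>i\<close>, so the inclusion into the full
    function space is measurable and \<open>Y\<close> can be read as a variable on the restricted space.\<close>
  have coord: "(\<lambda>f. f j) \<in> borel_measurable ?MA" for j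
  proof (cases "j = i")
    case True
    have "f j = undefined" if "f \<in> space ?MA" for f
      using that True by (simp add: space_PiM PiE_def extensional_def)
    then show ?thesis by (subst measurable_cong[where g = "\<lambda>_. undefined"]) simp_all
  next
    case False
    then show ?thesis by (intro measurable_component_singleton) simp
  qed
  have ident: "(\<lambda>f. f) \<in> borel_measurable ?MA"
    by (rule measurable_coordinatewise_then_product[of "\<lambda>f. f", OF coord])
  have "indep_var borel ((\<lambda>f. \<phi> (f i)) \<circ> (\<lambda>\<omega>. restrict \<omega> {i})) borel (Y \<circ> (\<lambda>\<omega>. restrict \<omega> ?A))"
    by (rule indep_var_compose[OF ir]) (use measurable_compose[OF ident Y] in auto)
  moreover have "(\<lambda>f. \<phi> (f i)) \<circ> (\<lambda>\<omega>. restrict \<omega> {i}) = (\<lambda>\<omega>. \<phi> (\<omega> i))" by auto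
  moreover have "Y \<circ> (\<lambda>\<omega>. restrict \<omega> ?A) = Y" 
    unfolding comp_def by (rule ext, rule indep) simp
  ultimately have ind: "indep_var borel (\<lambda>\<omega>. \<phi> (\<omega> i)) borel Y" by simp
  have "bounded ((\<lambda>\<omega>. \<phi> (\<omega> i)) ` environments R)"
    by (rule bounded_subset[OF b\<phi>]) (auto intro: jump_vector)
  then have "expectation (\<lambda>\<omega>. \<phi> (\<omega> i) * Y \<omega>) = expectation (\<lambda>\<omega>. \<phi> (\<omega> i)) * expectation Y"
    by (intro indep_var_lebesgue_integral ind integrable_env bY) measurable
  with expectation_site[OF \<phi>, of i] show ?thesis by simp
qed

lemma expectation_jump_mult:
  assumes "Y \<in> borel_measurable borel" "bounded (Y ` environments R)"
    and "\<And>\<omega> \<omega>'. (\<And>j. j \<noteq> i \<Longrightarrow> \<omega> j = \<omega>' j) \<Longrightarrow> Y \<omega> = Y \<omega>'"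
  shows "expectation (\<lambda>\<omega>. \<omega> i u * Y \<omega>) = mean_kernel P u * expectation Y"
  unfolding mean_kernel_def
  by (rule expectation_site_mult[of "\<lambda>q. q u", OF measurable_product_coordinates bounded_jump assms])

lemma sum_mean_kernel: "(\<Sum>u\<in>jumps. mean_kernel P u) = 1"
proof -
  have "(\<Sum>u\<in>jumps. mean_kernel P u) = expectation (\<lambda>\<omega>. \<Sum>u\<in>jumps. \<omega> (0, 0) u)"
    unfolding mean_kernel_def
    by (rule Bochner_Integration.integral_sum[symmetric])
       (intro integrable_env bounded_env_coordinate env_coordinate_measurable)
  also have "\<dots> = expectation (\<lambda>\<omega>. 1)"
    by (intro Bochner_Integration.integral_cong) (auto simp: space_P jump_sum jump_vector)
  finally show ?thesis by (simp add: prob_space)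
qed

text \<open>One more step into the past leaves the mean unchanged, even after weighting with a variable \<open>Y\<close>
  that depends only on times from \<open>t - N\<close> on: given these times, the mass on each site at time
  \<open>t - N\<close> has mean \<open>\<Sum>u. p(u) = 1\<close>. The recursion for the mass peels off the latest jump and not
  the earliest, so the induction on \<open>N\<close> absorbs the weight of this jump into \<open>Y\<close>.\<close>

lemma expectation_mass_Suc_mult:
  assumes "Y \<in> borel_measurable borel" "bounded (Y ` environments R)"
    and "\<And>\<omega> \<omega>'. (\<And>y s. t - int N \<le> s \<Longrightarrow> \<omega> (y, s) = \<omega>' (y, s)) \<Longrightarrow> Y \<omega> = Y \<omega>'"
  shows "expectation (\<lambda>\<omega>. mass (Suc N) x t \<omega> * Y \<omega>) = expectation (\<lambda>\<omega>. mass N x t \<omega> * Y \<omega>)"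
  using assms
proof (induction N arbitrary: x t Y)
  case 0
  note [measurable] = 0(1)
  have "expectation (\<lambda>\<omega>. mass (Suc 0) x t \<omega> * Y \<omega>) =
      expectation (\<lambda>\<omega>. \<Sum>u\<in>jumps. \<omega> (x - u, t - 1) u * Y \<omega>)"
    by (simp add: sum_distrib_right)
  also have "\<dots> = (\<Sum>u\<in>jumps. expectation (\<lambda>\<omega>. \<omega> (x - u, t - 1) u * Y \<omega>))"
    by (intro Bochner_Integration.integral_sum integrable_env bounded_comps bounded_env_coordinate 0(2))
       measurable
  also have "\<dots> = (\<Sum>u\<in>jumps. mean_kernel P u * expectation Y)"
  proof (intro sum.cong refl expectation_jump_mult[OF 0(1,2)])
    fix u and \<omega> \<omega>' :: "'d env"
    assume eq: "\<And>j. j \<noteq> (x - u, t - 1) \<Longrightarrow> \<omega> j = \<omega>' j"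
    show "Y \<omega> = Y \<omega>'" by (rule 0(3), rule eq) simp
  qed
  also have "\<dots> = expectation Y" by (simp flip: sum_distrib_right add: sum_mean_kernel)
  finally show ?case by simp
next
  case (Suc N)
  note [measurable] = Suc.prems(1)
  have split: "expectation (\<lambda>\<omega>. mass (Suc n) x t \<omega> * Y \<omega>) =
     (\<Sum>u\<in>jumps. expectation (\<lambda>\<omega>. mass n (x - u) (t - 1) \<omega> * (\<omega> (x - u, t - 1) u * Y \<omega>)))" for n
  proof -
    have "expectation (\<lambda>\<omega>. mass (Suc n) x t \<omega> * Y \<omega>) =
      expectation (\<lambda>\<omega>. \<Sum>u\<in>jumps. mass n (x - u) (t - 1) \<omega> * (\<omega> (x - u, t - 1) u * Y \<omega>))"
      by (intro Bochner_Integration.integral_cong) (auto simp: sum_distrib_right sum_distrib_left mult_ac)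
    also have "\<dots> = (\<Sum>u\<in>jumps. expectation (\<lambda>\<omega>. mass n (x - u) (t - 1) \<omega> * (\<omega> (x - u, t - 1) u * Y \<omega>)))"
      by (intro Bochner_Integration.integral_sum integrable_env bounded_comps bounded_env_coordinate
           bounded_mass Suc.prems(2)) measurable
    finally show ?thesis .
  qed
  show ?case unfolding split
  proof (intro sum.cong refl Suc.IH)
    fix u
    show "(\<lambda>\<omega>. \<omega> (x - u, t - 1) u * Y \<omega>) \<in> borel_measurable borel" by measurable
    show "bounded ((\<lambda>\<omega>. \<omega> (x - u, t - 1) u * Y \<omega>) ` environments R)"
      by (intro bounded_comps bounded_env_coordinate Suc.prems(2))
    fix \<omega> \<omega>' :: "'d env"
    assume eq: "\<And>y s. t - 1 - int N \<le> s \<Longrightarrow> \<omega> (y, s) = \<omega>' (y, s)"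
    have "Y \<omega> = Y \<omega>'" by (rule Suc.prems(3), rule eq) simp
    moreover have "\<omega> (x - u, t - 1) = \<omega>' (x - u, t - 1)" by (rule eq) simp
    ultimately show "\<omega> (x - u, t - 1) u * Y \<omega> = \<omega>' (x - u, t - 1) u * Y \<omega>'" by simp
  qed
qed

text \<open>Linear combinations of the masses at two sites are needed to obtain covariances from second
  moments by polarisation.\<close>

lemma bounded_martingale_mass:
  "bounded_martingale P (\<lambda>N \<omega>. a * mass N x t \<omega> + b * mass N y t \<omega>)"
proof (intro bounded_martingale.intro bounded_martingale_axioms.intro prob_space_axioms)
  fix n
  show "(\<lambda>\<omega>. a * mass n x t \<omega> + b * mass n y t \<omega>) \<in> borel_measurable P"
    by (intro measurable_P) measurable
  show "bounded ((\<lambda>\<omega>. a * mass n x t \<omega> + b * mass n y t \<omega>) ` space P)"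
    unfolding space_P by (intro bounded_comps bounded_mass)
next
  fix \<phi> :: "(nat \<Rightarrow> real) \<Rightarrow> real" and n
  define h where "h \<omega> k = a * mass (min k n) x t \<omega> + b * mass (min k n) y t \<omega>" for \<omega> k
  assume \<phi>: "\<phi> \<in> borel_measurable borel"
    and "bounded ((\<lambda>\<omega>. \<phi> (\<lambda>k. a * mass (min k n) x t \<omega> + b * mass (min k n) y t \<omega>)) ` space P)"
  then have bd: "bounded ((\<lambda>\<omega>. \<phi> (h \<omega>)) ` environments R)"
    by (simp add: h_def[abs_def] space_P)
  have h: "h \<in> borel_measurable borel"
    unfolding h_def[abs_def] by (rule measurable_coordinatewise_then_product) measurable
  note \<phi>h = measurable_compose[OF h \<phi>]
  have int: "integrable P (\<lambda>\<omega>. mass i z t \<omega> * \<phi> (h \<omega>))" for i z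
    by (intro integrable_env bounded_mult_comp bounded_mass bd borel_measurable_times
          arriving_mass_measurable \<phi>h)
  have eq: "expectation (\<lambda>\<omega>. (a * mass i x t \<omega> + b * mass i y t \<omega>) * \<phi> (h \<omega>)) =
     a * expectation (\<lambda>\<omega>. mass i x t \<omega> * \<phi> (h \<omega>)) + b * expectation (\<lambda>\<omega>. mass i y t \<omega> * \<phi> (h \<omega>))" for i
    by (simp add: distrib_right mult.assoc int)
  have step: "expectation (\<lambda>\<omega>. mass (Suc n) z t \<omega> * \<phi> (h \<omega>)) =
      expectation (\<lambda>\<omega>. mass n z t \<omega> * \<phi> (h \<omega>))" for z
  proof (rule expectation_mass_Suc_mult[OF \<phi>h bd])
    fix \<omega> \<omega>' :: "'d env"
    assume eq: "\<And>y s. t - int n \<le> s \<Longrightarrow> \<omega> (y, s) = \<omega>' (y, s)"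
    have "mass (min k n) z t \<omega> = mass (min k n) z t \<omega>'" for k z
      by (rule arriving_mass_cong) (rule eq, linarith)
    then have "h \<omega> = h \<omega>'" by (simp add: h_def fun_eq_iff)
    then show "\<phi> (h \<omega>) = \<phi> (h \<omega>')" by simp
  qed
  have "expectation (\<lambda>\<omega>. (a * mass (Suc n) x t \<omega> + b * mass (Suc n) y t \<omega>) * \<phi> (h \<omega>)) =
    expectation (\<lambda>\<omega>. (a * mass n x t \<omega> + b * mass n y t \<omega>) * \<phi> (h \<omega>))"
    unfolding eq by (simp only: step)
  then show "expectation (\<lambda>\<omega>. (a * mass (Suc n) x t \<omega> + b * mass (Suc n) y t \<omega>) *
      \<phi> (\<lambda>k. a * mass (min k n) x t \<omega> + b * mass (min k n) y t \<omega>)) =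
    expectation (\<lambda>\<omega>. (a * mass n x t \<omega> + b * mass n y t \<omega>) *
      \<phi> (\<lambda>k. a * mass (min k n) x t \<omega> + b * mass (min k n) y t \<omega>))"
    by (simp only: h_def[abs_def])
qed

section \<open>Pair correlations\<close>

text \<open>The expected product of the masses at two sites that differ by \<open>m\<close>. Two walks at different sites
  jump independently, with weight \<open>p(u) p(v)\<close>; two walks at a common site use the same jump vector,
  with weight \<open>E[\<omega>(u) \<omega>(v)]\<close>. Thus the constant function \<open>1\<close> evolves under the difference walk with a
  perturbation at the origin.\<close>

primrec correlation :: "nat \<Rightarrow> int ^ 'd \<Rightarrow> real" where
  "correlation 0 m = 1"
| "correlation (Suc N) m = (\<Sum>u\<in>jumps. \<Sum>v\<in>jumps.
     (if m + u - v = 0 then jump_moment u v else mean_kernel P u * mean_kernel P v) *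
     correlation N (m + u - v))"

text \<open>Splitting off the last jump of both walks leaves masses that depend only on times before \<open>t - 1\<close>,
  so the weights of these jumps factor out. The lemma is stated at all space-time points since the
  jumps shift them; stationarity of the masses in space and time comes out of the same induction.\<close>

lemma expectation_mass_mult:
  "expectation (\<lambda>\<omega>. mass N x t \<omega> * mass N y t \<omega>) = correlation N (y - x)"
proof (induction N arbitrary: x y t)
  case 0
  show ?case by (simp add: prob_space)
next
  case (Suc N)
  let ?Z = "\<lambda>u v \<omega>. mass N (x - u) (t - 1) \<omega> * mass N (y - v) (t - 1) \<omega>"
  have bZ: "bounded (?Z u v ` environments R)" for u v by (intro bounded_comps bounded_mass)
  have Z_cong: "?Z u v \<omega> = ?Z u v \<omega>'" if "\<And>z s. s \<noteq> t - 1 \<Longrightarrow> \<omega> (z, s) = \<omega>' (z, s)" for u v \<omega> \<omega>'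
  proof -
    have "mass N z (t - 1) \<omega> = mass N z (t - 1) \<omega>'" for z
      by (rule arriving_mass_cong) (rule that, simp)
    then show ?thesis by simp
  qed
  have "expectation (\<lambda>\<omega>. mass (Suc N) x t \<omega> * mass (Suc N) y t \<omega>) =
    expectation (\<lambda>\<omega>. \<Sum>u\<in>jumps. \<Sum>v\<in>jumps. \<omega> (x - u, t - 1) u * (\<omega> (y - v, t - 1) v * ?Z u v \<omega>))"
    unfolding arriving_mass.simps sum_product
    by (intro Bochner_Integration.integral_cong sum.cong refl) (simp only: mult_ac)
  also have "\<dots> = (\<Sum>u\<in>jumps. \<Sum>v\<in>jumps.
      expectation (\<lambda>\<omega>. \<omega> (x - u, t - 1) u * (\<omega> (y - v, t - 1) v * ?Z u v \<omega>)))"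
  proof -
    have int: "integrable P (\<lambda>\<omega>. \<omega> (x - u, t - 1) u * (\<omega> (y - v, t - 1) v * ?Z u v \<omega>))" for u v
      by (intro integrable_env bounded_comps bounded_env_coordinate bounded_mass) measurable
    show ?thesis
      by (simp only: Bochner_Integration.integral_sum Bochner_Integration.integrable_sum int)
  qed
  also have "\<dots> = correlation (Suc N) (y - x)"
    unfolding correlation.simps
  proof (intro sum.cong refl)
    fix u v
    have diff: "y - x + u - v = (y - v) - (x - u)" by simp
    have Z: "expectation (?Z u v) = correlation N (y - x + u - v)"
      unfolding diff by (rule Suc.IH)
    show "expectation (\<lambda>\<omega>. \<omega> (x - u, t - 1) u * (\<omega> (y - v, t - 1) v * ?Z u v \<omega>)) =
      (if y - x + u - v = 0 then jump_moment u v else mean_kernel P u * mean_kernel P v) *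
       correlation N (y - x + u - v)"
    proof (cases "x - u = y - v")
      case True
      with diff have zero: "y - x + u - v = 0" by simp
      have site: "expectation (\<lambda>\<omega>. \<omega> (x - u, t - 1) u * (\<omega> (y - v, t - 1) v * ?Z u v \<omega>)) =
        expectation (\<lambda>\<omega>. (\<omega> (x - u, t - 1) u * \<omega> (x - u, t - 1) v) * ?Z u v \<omega>)"
        by (simp only: True mult.assoc)
      have "expectation (\<lambda>\<omega>. (\<omega> (x - u, t - 1) u * \<omega> (x - u, t - 1) v) * ?Z u v \<omega>) =
        jump_moment u v * expectation (?Z u v)"
        unfolding jump_moment_def
      proof (rule expectation_site_mult[of "\<lambda>q. q u * q v", OF _ _ _ bZ])
        show "bounded ((\<lambda>q. q u * q v) ` prob_vectors R)" by (intro bounded_comps bounded_jump)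
        show "(\<lambda>q :: int ^ 'd \<Rightarrow> real. q u * q v) \<in> borel_measurable borel"
          by (intro borel_measurable_times measurable_product_coordinates)
        show "?Z u v \<in> borel_measurable borel" by measurable
        fix \<omega> \<omega>' :: "'d env"
        assume eq: "\<And>j. j \<noteq> (x - u, t - 1) \<Longrightarrow> \<omega> j = \<omega>' j"
        show "?Z u v \<omega> = ?Z u v \<omega>'" by (rule Z_cong) (auto intro: eq)
      qed
      then show ?thesis unfolding site by (simp only: Z zero if_True refl)
    next
      case False
      then have nonzero: "y - x + u - v \<noteq> 0" unfolding diff by simp
      have 1: "expectation (\<lambda>\<omega>. \<omega> (x - u, t - 1) u * (\<omega> (y - v, t - 1) v * ?Z u v \<omega>)) =
        mean_kernel P u * expectation (\<lambda>\<omega>. \<omega> (y - v, t - 1) v * ?Z u v \<omega>)"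
      proof (rule expectation_jump_mult)
        show "bounded ((\<lambda>\<omega>. \<omega> (y - v, t - 1) v * ?Z u v \<omega>) ` environments R)"
          by (intro bounded_comps bounded_env_coordinate bounded_mass)
        show "(\<lambda>\<omega>. \<omega> (y - v, t - 1) v * ?Z u v \<omega>) \<in> borel_measurable borel" by measurable
        fix \<omega> \<omega>' :: "'d env"
        assume eq: "\<And>j. j \<noteq> (x - u, t - 1) \<Longrightarrow> \<omega> j = \<omega>' j"
        have "?Z u v \<omega> = ?Z u v \<omega>'" by (rule Z_cong) (auto intro: eq)
        moreover have "\<omega> (y - v, t - 1) = \<omega>' (y - v, t - 1)" using False by (intro eq) auto
        ultimately show "\<omega> (y - v, t - 1) v * ?Z u v \<omega> = \<omega>' (y - v, t - 1) v * ?Z u v \<omega>'" by simp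
      qed
      have 2: "expectation (\<lambda>\<omega>. \<omega> (y - v, t - 1) v * ?Z u v \<omega>) = mean_kernel P v * expectation (?Z u v)"
      proof (rule expectation_jump_mult[OF _ bZ])
        show "?Z u v \<in> borel_measurable borel" by measurable
        fix \<omega> \<omega>' :: "'d env"
        assume eq: "\<And>j. j \<noteq> (y - v, t - 1) \<Longrightarrow> \<omega> j = \<omega>' j"
        show "?Z u v \<omega> = ?Z u v \<omega>'" by (rule Z_cong) (auto intro: eq)
      qed
      show ?thesis unfolding 1 2 Z by (simp only: nonzero if_False mult.assoc)
    qed
  qed
  finally show ?case .
qed

end

section \<open>From transition probabilities to the density\<close>

lemma infsum_finite_support:
  fixes f :: "'a \<Rightarrow> real"
  assumes "finite F" "\<And>x. x \<notin> F \<Longrightarrow> f x = 0"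
  shows "(\<Sum>\<^sub>\<infinity>x. f x) = (\<Sum>x\<in>F. f x)"
proof -
  have "infsum f UNIV = infsum f F" by (rule infsum_cong_neutral) (use assms in auto)
  then show ?thesis using assms by simp
qed

context iid_random_environment
begin

text \<open>On admissible environments the infinite sum over intermediate sites is a sum over the last jump.\<close>

lemma steps_prob_Suc:
  fixes \<omega> :: "'d env"
  assumes \<omega>: "\<omega> \<in> environments R"
  shows "steps_prob \<omega> s (Suc n) x y =
    (\<Sum>u\<in>jumps. steps_prob \<omega> s n x (y - u) * \<omega> (y - u, s + int n) u)"
proof -
  have "steps_prob \<omega> s (Suc n) x y =
      (\<Sum>z\<in>(\<lambda>u. y - u) ` jumps. steps_prob \<omega> s n x z * step_prob \<omega> (s + int n) z y)"
    unfolding steps_prob.simps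
  proof (rule infsum_finite_support)
    fix z assume "z \<notin> (\<lambda>u. y - u) ` jumps"
    then have "y - z \<notin> jumps" by (metis diff_diff_eq2 add_diff_cancel_left' image_eqI)
    then show "steps_prob \<omega> s n x z * step_prob \<omega> (s + int n) z y = 0"
      unfolding step_prob_def using jump_outside[OF jump_vector[OF \<omega>]] by simp
  qed (simp add: finite_jumps)
  also have "\<dots> = (\<Sum>u\<in>jumps. steps_prob \<omega> s n x (y - u) * \<omega> (y - u, s + int n) u)"
    by (subst sum.reindex) (auto simp: inj_on_def step_prob_def)
  finally show ?thesis .
qed

lemma finite_steps_prob_support:
  fixes \<omega> :: "'d env"
  assumes \<omega>: "\<omega> \<in> environments R"
  shows "finite {x. steps_prob \<omega> s n x y \<noteq> 0}"
proof (induction n arbitrary: y)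
  case (Suc n)
  have "{x. steps_prob \<omega> s (Suc n) x y \<noteq> 0} \<subseteq> (\<Union>u\<in>jumps. {x. steps_prob \<omega> s n x (y - u) \<noteq> 0})"
  proof (rule subsetI, rule ccontr)
    fix x assume x: "x \<in> {x. steps_prob \<omega> s (Suc n) x y \<noteq> 0}"
      "x \<notin> (\<Union>u\<in>jumps. {x. steps_prob \<omega> s n x (y - u) \<noteq> 0})"
    then have "steps_prob \<omega> s (Suc n) x y = 0"
      unfolding steps_prob_Suc[OF \<omega>] by (intro sum.neutral) auto
    with x show False by auto
  qed
  then show ?case by (rule finite_subset) (use Suc finite_jumps in auto)
qed auto

text \<open>Summing the recursion for the transition probabilities over the starting point gives the
  recursion for the arriving mass; the finite supports permit the exchange of the sums.\<close>

lemma infsum_steps_prob: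
  fixes \<omega> :: "'d env"
  assumes \<omega>: "\<omega> \<in> environments R"
  shows "(\<Sum>\<^sub>\<infinity>x. steps_prob \<omega> s n x y) = mass n y (s + int n) \<omega>"
proof (induction n arbitrary: y)
  case 0
  have "(\<Sum>\<^sub>\<infinity>x. steps_prob \<omega> s 0 x y) = (\<Sum>x\<in>{y}. steps_prob \<omega> s 0 x y)"
    by (rule infsum_finite_support) auto
  then show ?case by simp
next
  case (Suc n)
  let ?F = "\<Union>u\<in>jumps. {x. steps_prob \<omega> s n x (y - u) \<noteq> 0}"
  have F: "finite ?F" using finite_steps_prob_support[OF \<omega>] finite_jumps by auto
  have "(\<Sum>\<^sub>\<infinity>x. steps_prob \<omega> s (Suc n) x y) = (\<Sum>x\<in>?F. steps_prob \<omega> s (Suc n) x y)"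
    unfolding steps_prob_Suc[OF \<omega>] by (rule infsum_finite_support[OF F]) (auto intro!: sum.neutral)
  also have "\<dots> = (\<Sum>u\<in>jumps. (\<Sum>x\<in>?F. steps_prob \<omega> s n x (y - u)) * \<omega> (y - u, s + int n) u)"
    unfolding steps_prob_Suc[OF \<omega>] sum_distrib_right by (rule sum.swap)
  also have "\<dots> = (\<Sum>u\<in>jumps. mass n (y - u) (s + int n) \<omega> * \<omega> (y - u, s + int n) u)"
  proof (intro sum.cong refl arg_cong2[of _ _ _ _ "(*)"])
    fix u assume "u \<in> jumps"
    then have "(\<Sum>\<^sub>\<infinity>x. steps_prob \<omega> s n x (y - u)) = (\<Sum>x\<in>?F. steps_prob \<omega> s n x (y - u))"
      by (intro infsum_finite_support[OF F]) auto
    with Suc.IH[of "y - u"]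
    show "(\<Sum>x\<in>?F. steps_prob \<omega> s n x (y - u)) = mass n (y - u) (s + int n) \<omega>" by simp
  qed
  also have "\<dots> = mass (Suc n) y (s + int (Suc n)) \<omega>"
    by (simp add: mult.commute)
  finally show ?case .
qed

lemma env_shift_environments: "\<omega> \<in> environments R \<Longrightarrow> env_shift x s (\<omega> :: 'd env) \<in> environments R"
  by (simp add: environments_def env_shift_def)

definition limit_mass :: "int ^ 'd \<Rightarrow> 'd env \<Rightarrow> real" where
  "limit_mass x \<omega> = lim (\<lambda>N. mass N x 0 \<omega>)"

lemma quenched_density_env_shift:
  fixes \<omega> :: "'d env"
  assumes "\<omega> \<in> environments R"
  shows "quenched_density (env_shift x 0 \<omega>) = limit_mass x \<omega>"
  unfolding quenched_density_def limit_mass_def quenched_density_approx_def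
  by (simp add: infsum_steps_prob[OF env_shift_environments[OF assms]] arriving_mass_env_shift)

lemma quenched_density_eq:
  fixes \<omega> :: "'d env"
  assumes "\<omega> \<in> environments R"
  shows "quenched_density \<omega> = limit_mass 0 \<omega>"
  using quenched_density_env_shift[OF assms, of 0] by (simp add: env_shift_def)

lemma limit_mass_measurable [measurable]: "limit_mass x \<in> borel_measurable P"
  unfolding limit_mass_def by (intro measurable_P borel_measurable_lim_metric arriving_mass_measurable)

lemma expectation_square_combination:
  "expectation (\<lambda>\<omega>. (a * mass N x t \<omega> + b * mass N y t \<omega>)\<^sup>2) =
    (a\<^sup>2 + b\<^sup>2) * correlation N 0 + 2 * a * b * correlation N (y - x)"
proof -
  have int: "integrable P (\<lambda>\<omega>. mass N z t \<omega> * mass N w t \<omega>)" for z w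
    by (intro integrable_env bounded_mult_comp bounded_mass borel_measurable_times arriving_mass_measurable)
  have "expectation (\<lambda>\<omega>. (a * mass N x t \<omega> + b * mass N y t \<omega>)\<^sup>2) =
    expectation (\<lambda>\<omega>. a\<^sup>2 * (mass N x t \<omega> * mass N x t \<omega>) + b\<^sup>2 * (mass N y t \<omega> * mass N y t \<omega>)
      + 2 * a * b * (mass N x t \<omega> * mass N y t \<omega>))"
    by (intro Bochner_Integration.integral_cong) (auto simp: power2_eq_square algebra_simps)
  also have "\<dots> = a\<^sup>2 * expectation (\<lambda>\<omega>. mass N x t \<omega> * mass N x t \<omega>)
      + b\<^sup>2 * expectation (\<lambda>\<omega>. mass N y t \<omega> * mass N y t \<omega>)
      + 2 * a * b * expectation (\<lambda>\<omega>. mass N x t \<omega> * mass N y t \<omega>)"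
    by (simp add: int)
  finally show ?thesis by (simp add: expectation_mass_mult algebra_simps)
qed

text \<open>At \<open>m = 0\<close> the correlation is the second moment of a martingale.\<close>

lemma correlation_mono: "mono (\<lambda>N. correlation N 0)"
proof -
  interpret m: bounded_martingale P "\<lambda>N \<omega>. 1 * mass N 0 0 \<omega> + 0 * mass N 0 0 \<omega>"
    by (rule bounded_martingale_mass)
  show ?thesis using m.expectation_square_mono unfolding expectation_square_combination by simp
qed

text \<open>Convergence of all pair correlations is enough to identify the covariances of the limiting
  density; the limit \<open>c\<close> is computed by Fourier analysis below.\<close>

context
  fixes c :: "int ^ 'd \<Rightarrow> real"
  assumes c: "\<And>m. (\<lambda>N. correlation N m) \<longlonglongrightarrow> c m"
begin

lemma square_combination_bound:
  obtains K where "\<And>N. expectation (\<lambda>\<omega>. (a * mass N x t \<omega> + b * mass N y t \<omega>)\<^sup>2) \<le> K"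
proof -
  have "(\<lambda>N. expectation (\<lambda>\<omega>. (a * mass N x t \<omega> + b * mass N y t \<omega>)\<^sup>2))
      \<longlonglongrightarrow> (a\<^sup>2 + b\<^sup>2) * c 0 + 2 * a * b * c (y - x)"
    unfolding expectation_square_combination by (intro tendsto_intros c)
  then have "Bseq (\<lambda>N. expectation (\<lambda>\<omega>. (a * mass N x t \<omega> + b * mass N y t \<omega>)\<^sup>2))"
    by (intro convergent_imp_Bseq) (auto simp: convergent_def)
  then obtain K where "\<And>N. \<bar>expectation (\<lambda>\<omega>. (a * mass N x t \<omega> + b * mass N y t \<omega>)\<^sup>2)\<bar> \<le> K"
    unfolding Bseq_def by auto
  then have "expectation (\<lambda>\<omega>. (a * mass N x t \<omega> + b * mass N y t \<omega>)\<^sup>2) \<le> K" for N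
    by (rule order_trans[OF abs_ge_self])
  then show ?thesis by (rule that)
qed

lemma AE_mass_tendsto: "AE \<omega> in P. (\<lambda>N. mass N x 0 \<omega>) \<longlonglongrightarrow> limit_mass x \<omega>"
proof -
  interpret m: bounded_martingale P "\<lambda>N \<omega>. 1 * mass N x 0 \<omega> + 0 * mass N x 0 \<omega>"
    by (rule bounded_martingale_mass)
  obtain K where "\<And>N. expectation (\<lambda>\<omega>. (1 * mass N x 0 \<omega> + 0 * mass N x 0 \<omega>)\<^sup>2) \<le> K"
    using square_combination_bound[of 1 x 0 0 x] by blast
  from m.AE_convergent[OF this] have "AE \<omega> in P. convergent (\<lambda>N. mass N x 0 \<omega>)" by simp
  then show ?thesis unfolding limit_mass_def by eventually_elim (simp add: convergent_LIMSEQ_iff)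
qed

lemma limit_mass_combination:
  fixes a b :: real and x y :: "int ^ 'd"
  defines "Y \<equiv> \<lambda>\<omega>. a * limit_mass x \<omega> + b * limit_mass y \<omega>"
  shows "integrable P Y" "expectation Y = a + b"
    "integrable P (\<lambda>\<omega>. (Y \<omega>)\<^sup>2)" "expectation (\<lambda>\<omega>. (Y \<omega>)\<^sup>2) = (a\<^sup>2 + b\<^sup>2) * c 0 + 2 * a * b * c (y - x)"
proof -
  interpret m: bounded_martingale P "\<lambda>N \<omega>. a * mass N x 0 \<omega> + b * mass N y 0 \<omega>"
    by (rule bounded_martingale_mass)
  obtain K where K: "\<And>N. expectation (\<lambda>\<omega>. (a * mass N x 0 \<omega> + b * mass N y 0 \<omega>)\<^sup>2) \<le> K"
    using square_combination_bound[of a x 0 b y] by blast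
  have Y: "Y \<in> borel_measurable P" unfolding Y_def by measurable
  have lim: "AE \<omega> in P. (\<lambda>N. a * mass N x 0 \<omega> + b * mass N y 0 \<omega>) \<longlonglongrightarrow> Y \<omega>"
    using AE_mass_tendsto[of x] AE_mass_tendsto[of y]
    unfolding Y_def by eventually_elim (intro tendsto_intros)
  note mom = m.limit_moments[OF K Y lim]
  show "integrable P Y" "integrable P (\<lambda>\<omega>. (Y \<omega>)\<^sup>2)" by (rule mom)+
  show "expectation Y = a + b" using mom(3) by (simp add: prob_space)
  have "(\<lambda>N. expectation (\<lambda>\<omega>. (a * mass N x 0 \<omega> + b * mass N y 0 \<omega>)\<^sup>2))
      \<longlonglongrightarrow> (a\<^sup>2 + b\<^sup>2) * c 0 + 2 * a * b * c (y - x)"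
    unfolding expectation_square_combination by (intro tendsto_intros c)
  from LIMSEQ_unique[OF mom(4) this]
  show "expectation (\<lambda>\<omega>. (Y \<omega>)\<^sup>2) = (a\<^sup>2 + b\<^sup>2) * c 0 + 2 * a * b * c (y - x)" .
qed

text \<open>Polarisation: the mixed moment is read off from the second moments of \<open>X\<close>, \<open>Y\<close> and \<open>X + Y\<close>.\<close>

lemma limit_mass_covariance: "covariance (limit_mass x) (limit_mass y) = c (y - x) - 1"
proof -
  let ?X = "limit_mass x" and ?Y = "limit_mass y"
  have X: "integrable P ?X" "expectation ?X = 1" "integrable P (\<lambda>\<omega>. (?X \<omega>)\<^sup>2)"
      "expectation (\<lambda>\<omega>. (?X \<omega>)\<^sup>2) = c 0"
    and Y: "integrable P ?Y" "expectation ?Y = 1" "integrable P (\<lambda>\<omega>. (?Y \<omega>)\<^sup>2)"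
      "expectation (\<lambda>\<omega>. (?Y \<omega>)\<^sup>2) = c 0"
    using limit_mass_combination[of 1 x 0 x] limit_mass_combination[of 1 y 0 y] by simp_all
  have S: "integrable P (\<lambda>\<omega>. (?X \<omega> + ?Y \<omega>)\<^sup>2)"
      "expectation (\<lambda>\<omega>. (?X \<omega> + ?Y \<omega>)\<^sup>2) = 2 * c 0 + 2 * c (y - x)"
    using limit_mass_combination(3,4)[of 1 x 1 y] by simp_all
  have "covariance ?X ?Y =
    expectation (\<lambda>\<omega>. ((?X \<omega> + ?Y \<omega>)\<^sup>2 - (?X \<omega>)\<^sup>2 - (?Y \<omega>)\<^sup>2) / 2 - ?X \<omega> - ?Y \<omega> + 1)"
    unfolding covariance_def X(2) Y(2)
    by (intro Bochner_Integration.integral_cong) (auto simp: power2_eq_square algebra_simps)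
  also have "\<dots> = c (y - x) - 1"
    using X Y S by (simp add: prob_space)
  finally show ?thesis .
qed

lemma quenched_density_covariance:
  "covariance quenched_density (\<lambda>\<omega>. quenched_density (env_shift m 0 \<omega>)) = c m - 1"
proof -
  have f: "quenched_density \<omega> = limit_mass 0 \<omega>"
      "quenched_density (env_shift m 0 \<omega>) = limit_mass m \<omega>" if "\<omega> \<in> space P" for \<omega>
    using quenched_density_eq quenched_density_env_shift that space_P by auto
  have "expectation quenched_density = expectation (limit_mass 0)"
      "expectation (\<lambda>\<omega>. quenched_density (env_shift m 0 \<omega>)) = expectation (limit_mass m)"
    by (intro Bochner_Integration.integral_cong refl f; assumption)+
  then have "covariance quenched_density (\<lambda>\<omega>. quenched_density (env_shift m 0 \<omega>)) =
      covariance (limit_mass 0) (limit_mass m)"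
    unfolding covariance_def by (intro Bochner_Integration.integral_cong refl) (simp add: f)
  then show ?thesis by (simp add: limit_mass_covariance)
qed

lemma quenched_density_variance: "variance quenched_density = c 0 - 1"
proof -
  have "variance quenched_density =
      covariance quenched_density (\<lambda>\<omega>. quenched_density (env_shift 0 0 \<omega>))"
    by (simp add: covariance_def env_shift_def power2_eq_square)
  then show ?thesis by (simp add: quenched_density_covariance)
qed

end

section \<open>Characteristic functions of the jump vectors\<close>

lemma cmod_square_char_sum:
  fixes q :: "int ^ 'd \<Rightarrow> real"
  shows "complex_of_real ((cmod (\<Sum>u\<in>jumps. of_real (q u) * cis (\<theta> \<bullet> real_vec u)))\<^sup>2) =
    (\<Sum>u\<in>jumps. \<Sum>v\<in>jumps. of_real (q u * q v) * cis (\<theta> \<bullet> real_vec (u - v)))"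
proof -
  have "complex_of_real ((cmod (\<Sum>u\<in>jumps. of_real (q u) * cis (\<theta> \<bullet> real_vec u)))\<^sup>2) =
    (\<Sum>u\<in>jumps. of_real (q u) * cis (\<theta> \<bullet> real_vec u)) * (\<Sum>v\<in>jumps. of_real (q v) * cis (- (\<theta> \<bullet> real_vec v)))"
    unfolding complex_norm_square by (simp add: cis_cnj)
  also have "\<dots> = (\<Sum>u\<in>jumps. \<Sum>v\<in>jumps. of_real (q u * q v) * cis (\<theta> \<bullet> real_vec (u - v)))"
  proof -
    have "cis (\<theta> \<bullet> real_vec (u - v)) = cis (\<theta> \<bullet> real_vec u) * cis (- (\<theta> \<bullet> real_vec v))" for u v :: "int ^ 'd"
      by (simp add: cis_mult real_vec_diff inner_diff_right)
    then show ?thesis unfolding sum_product by (simp only: of_real_mult mult_ac)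
  qed
  finally show ?thesis .
qed

lemma char_fun_eq:
  assumes "\<omega> \<in> environments R"
  shows "char_fun \<omega> \<theta> = (\<Sum>u\<in>jumps. of_real (\<omega> (0, 0) u) * cis (\<theta> \<bullet> real_vec (u :: int ^ 'd)))"
proof -
  have "char_fun \<omega> \<theta> = infsum (\<lambda>u. of_real (\<omega> (0, 0) u) * cis (\<theta> \<bullet> real_vec u)) jumps"
    unfolding char_fun_def
    by (rule infsum_cong_neutral) (auto simp: jump_outside[OF jump_vector[OF assms]])
  then show ?thesis using finite_jumps by simp
qed

lemma integrable_jump_product: "integrable P (\<lambda>\<omega>. \<omega> i u * \<omega> i v)"
  by (intro integrable_env bounded_mult_comp bounded_env_coordinate) measurable

lemma integrable_jump: "integrable P (\<lambda>\<omega>. \<omega> i u)"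
  by (intro integrable_env bounded_env_coordinate env_coordinate_measurable)

text \<open>Both \<open>lam P\<close> and \<open>lam_bar P\<close> are trigonometric polynomials, whose coefficients are the two kinds
  of weights in the recursion for the correlations.\<close>

lemma lam_expansion:
  "complex_of_real (lam P \<theta>) =
    (\<Sum>u\<in>jumps. \<Sum>v\<in>jumps. of_real (jump_moment u v) * cis (\<theta> \<bullet> real_vec (u - v)))"
proof -
  have int: "integrable P (\<lambda>\<omega>. complex_of_real (\<omega> (0, 0) u * \<omega> (0, 0) v))" for u v
    using integrable_jump_product by (rule integrable_of_real)
  have "complex_of_real (lam P \<theta>) = expectation (\<lambda>\<omega>. complex_of_real ((cmod (char_fun \<omega> \<theta>))\<^sup>2))"
    unfolding lam_def by (rule integral_complex_of_real[symmetric])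
  also have "\<dots> = expectation (\<lambda>\<omega>. \<Sum>u\<in>jumps. \<Sum>v\<in>jumps.
      complex_of_real (\<omega> (0, 0) u * \<omega> (0, 0) v) * cis (\<theta> \<bullet> real_vec (u - v)))"
    by (intro Bochner_Integration.integral_cong refl)
       (simp only: space_P char_fun_eq cmod_square_char_sum)
  also have "\<dots> = (\<Sum>u\<in>jumps. \<Sum>v\<in>jumps.
      expectation (\<lambda>\<omega>. complex_of_real (\<omega> (0, 0) u * \<omega> (0, 0) v)) * cis (\<theta> \<bullet> real_vec (u - v)))"
    by (simp only: Bochner_Integration.integral_sum Bochner_Integration.integrable_sum
         integrable_mult_left integral_mult_left_zero int)
  finally show ?thesis by (simp only: integral_complex_of_real jump_moment_def)
qed

lemma lam_bar_expansion:
  "complex_of_real (lam_bar P \<theta>) =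
    (\<Sum>u\<in>jumps. \<Sum>v\<in>jumps. of_real (mean_kernel P u * mean_kernel P v) * cis (\<theta> \<bullet> real_vec (u - v)))"
proof -
  have int: "integrable P (\<lambda>\<omega>. complex_of_real (\<omega> (0, 0) u))" for u
    using integrable_jump by (rule integrable_of_real)
  have "expectation (\<lambda>\<omega>. char_fun \<omega> \<theta>) =
      expectation (\<lambda>\<omega>. \<Sum>u\<in>jumps. of_real (\<omega> (0, 0) u) * cis (\<theta> \<bullet> real_vec u))"
    by (intro Bochner_Integration.integral_cong refl) (simp only: space_P char_fun_eq)
  also have "\<dots> = (\<Sum>u\<in>jumps. of_real (mean_kernel P u) * cis (\<theta> \<bullet> real_vec u))"
    by (simp only: Bochner_Integration.integral_sum integrable_mult_left integral_mult_left_zero int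
         integral_complex_of_real mean_kernel_def)
  finally show ?thesis unfolding lam_bar_def by (simp only: cmod_square_char_sum)
qed

lemma lam_cos_expansion:
  "lam P \<theta> = (\<Sum>u\<in>jumps. \<Sum>v\<in>jumps. jump_moment u v * cos (\<theta> \<bullet> real_vec (u - v)))"
  using arg_cong[OF lam_expansion[of \<theta>], of Re] by simp

lemma lam_bar_cos_expansion:
  "lam_bar P \<theta> =
    (\<Sum>u\<in>jumps. \<Sum>v\<in>jumps. mean_kernel P u * mean_kernel P v * cos (\<theta> \<bullet> real_vec (u - v)))"
  using arg_cong[OF lam_bar_expansion[of \<theta>], of Re] by simp

lemma lam_measurable [measurable]: "lam P \<in> borel_measurable borel"
proof -
  have "lam P = (\<lambda>\<theta>. \<Sum>u\<in>jumps. \<Sum>v\<in>jumps. jump_moment u v * cos (\<theta> \<bullet> real_vec (u - v)))"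
    by (rule ext) (rule lam_cos_expansion)
  then show ?thesis by simp
qed

lemma lam_bar_measurable [measurable]: "lam_bar P \<in> borel_measurable borel"
proof -
  have "lam_bar P = (\<lambda>\<theta>. \<Sum>u\<in>jumps. \<Sum>v\<in>jumps.
      mean_kernel P u * mean_kernel P v * cos (\<theta> \<bullet> real_vec (u - v)))"
    by (rule ext) (rule lam_bar_cos_expansion)
  then show ?thesis by simp
qed

lemma env_coordinate_nonneg: "\<omega> \<in> environments R \<Longrightarrow> 0 \<le> \<omega> i (u :: int ^ 'd)"
  by (rule jump_nonneg[OF jump_vector])

lemma jump_moment_nonneg: "0 \<le> jump_moment u v"
  unfolding jump_moment_def
  by (intro Bochner_Integration.integral_nonneg mult_nonneg_nonneg env_coordinate_nonneg)
     (simp_all add: space_P)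

lemma sum_jump_moment: "(\<Sum>u\<in>jumps. \<Sum>v\<in>jumps. jump_moment u v) = 1"
proof -
  have "(\<Sum>u\<in>jumps. \<Sum>v\<in>jumps. jump_moment u v) =
      expectation (\<lambda>\<omega>. \<Sum>u\<in>jumps. \<Sum>v\<in>jumps. \<omega> (0, 0) u * \<omega> (0, 0) v)"
    unfolding jump_moment_def
    by (simp only: Bochner_Integration.integral_sum Bochner_Integration.integrable_sum integrable_jump_product)
  also have "\<dots> = expectation (\<lambda>\<omega>. 1)"
    by (intro Bochner_Integration.integral_cong refl)
       (simp add: sum_product[symmetric] space_P jump_sum jump_vector)
  finally show ?thesis by (simp add: prob_space)
qed

lemma lam_bar_nonneg: "0 \<le> lam_bar P \<theta>"
  by (simp add: lam_bar_def)

lemma one_minus_lam: "1 - lam P \<theta> =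
    (\<Sum>u\<in>jumps. \<Sum>v\<in>jumps. jump_moment u v * (1 - cos (\<theta> \<bullet> real_vec (u - v))))"
  using sum_jump_moment by (simp add: lam_cos_expansion sum_subtractf right_diff_distrib)

lemma lam_le_1: "lam P \<theta> \<le> 1"
proof -
  have "0 \<le> 1 - lam P \<theta>"
    unfolding one_minus_lam by (intro sum_nonneg mult_nonneg_nonneg jump_moment_nonneg) simp
  then show ?thesis by simp
qed

text \<open>Jensen's inequality, first for the modulus of an expectation and then for the square.\<close>

lemma lam_bar_le_lam: "lam_bar P \<theta> \<le> lam P \<theta>"
proof -
  have "(\<lambda>\<omega>. \<Sum>u\<in>jumps. of_real (\<omega> (0, 0) u) * cis (\<theta> \<bullet> real_vec u)) \<in> borel_measurable P"
    by (intro measurable_P) measurable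
  then have meas [measurable]: "(\<lambda>\<omega>. char_fun \<omega> \<theta>) \<in> borel_measurable P"
    by (subst measurable_cong) (auto simp: space_P char_fun_eq)
  have bound: "cmod (char_fun \<omega> \<theta>) \<le> 1" if \<omega>: "\<omega> \<in> space P" for \<omega>
  proof -
    have "cmod (char_fun \<omega> \<theta>) \<le> (\<Sum>u\<in>jumps. \<omega> (0, 0) u)"
      unfolding char_fun_eq[OF \<omega>[unfolded space_P]]
      by (rule sum_norm_le)
         (use \<omega> in \<open>auto simp: norm_mult space_P intro!: jump_nonneg jump_vector\<close>)
    then show ?thesis using \<omega> by (simp add: space_P jump_sum jump_vector)
  qed
  have int: "integrable P (\<lambda>\<omega>. cmod (char_fun \<omega> \<theta>))"
    by (rule integrable_const_bound[of _ 1]) (auto intro: bound)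
  have int2: "integrable P (\<lambda>\<omega>. (cmod (char_fun \<omega> \<theta>))\<^sup>2)"
    by (rule integrable_const_bound[of _ 1]) (auto intro!: power_le_one bound)
  have "cmod (expectation (\<lambda>\<omega>. char_fun \<omega> \<theta>)) \<le> expectation (\<lambda>\<omega>. cmod (char_fun \<omega> \<theta>))"
    by (rule integral_norm_bound)
  then have "lam_bar P \<theta> \<le> (expectation (\<lambda>\<omega>. cmod (char_fun \<omega> \<theta>)))\<^sup>2"
    unfolding lam_bar_def by (intro power_mono) auto
  also have "\<dots> \<le> lam P \<theta>"
    using variance_positive[of "\<lambda>\<omega>. cmod (char_fun \<omega> \<theta>)"] variance_eq[OF int int2]
    unfolding lam_def by simp
  finally show ?thesis .
qed

text \<open>Nondegeneracy gives two different jumps \<open>z\<close>, \<open>z'\<close> that some jump vectors charge simultaneously, so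
  \<open>1 - lam P \<theta>\<close> is at least a positive multiple of \<open>1 - cos (\<theta> \<bullet> (z - z'))\<close>.\<close>

lemma AE_lam_less_1:
  assumes nd: "nondegenerate_environment P"
  shows "AE \<theta> in torus_measure. lam P \<theta> < 1"
proof -
  have "\<exists>z\<in>jumps. \<exists>z'\<in>jumps. z \<noteq> z' \<and> jump_moment z z' > 0"
  proof (rule ccontr)
    assume neg: "\<not> ?thesis"
    have zero: "jump_moment z z' = 0" if "z \<in> jumps" "z' \<in> jumps" "z \<noteq> z'" for z z'
      using that neg jump_moment_nonneg[of z z'] by (metis order_le_less)
    have "AE \<omega> in P. \<omega> (0, 0) z * \<omega> (0, 0) z' = 0" if "z \<in> jumps" "z' \<in> jumps" "z \<noteq> z'" for z z'
    proof (rule integral_nonneg_eq_0_iff_AE[THEN iffD1])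
      show "AE \<omega> in P. 0 \<le> \<omega> (0, 0) z * \<omega> (0, 0) z'"
        by (intro AE_I2 mult_nonneg_nonneg env_coordinate_nonneg) (simp_all add: space_P)
      show "expectation (\<lambda>\<omega>. \<omega> (0, 0) z * \<omega> (0, 0) z') = 0"
        using zero[OF that] unfolding jump_moment_def .
    qed (rule integrable_jump_product)
    then have "AE \<omega> in P. \<forall>z\<in>jumps. \<forall>z'\<in>jumps. z \<noteq> z' \<longrightarrow> \<omega> (0, 0) z * \<omega> (0, 0) z' = 0"
      using finite_jumps by (auto simp: AE_finite_all)
    then have "AE \<omega> in P. \<not> (\<exists>z. 0 < \<omega> (0, 0) z \<and> \<omega> (0, 0) z < 1)"
      using AE_space
    proof eventually_elim
      case (elim \<omega>)
      then have q: "\<omega> (0, 0) \<in> prob_vectors R" by (simp add: space_P jump_vector)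
      show ?case
      proof
        assume "\<exists>z. 0 < \<omega> (0, 0) z \<and> \<omega> (0, 0) z < 1"
        then obtain z where z: "0 < \<omega> (0, 0) z" "\<omega> (0, 0) z < 1" by blast
        then have "z \<in> jumps" using jump_outside[OF q, of z] by fastforce
        then have "(\<Sum>u\<in>jumps. \<omega> (0, 0) u) = \<omega> (0, 0) z + (\<Sum>u\<in>jumps - {z}. \<omega> (0, 0) u)"
          using finite_jumps by (simp add: sum.remove)
        also have "(\<Sum>u\<in>jumps - {z}. \<omega> (0, 0) u) = 0"
          using elim(1) z \<open>z \<in> jumps\<close> by (intro sum.neutral) fastforce
        finally show False using jump_sum[OF q] z by simp
      qed
    qed
    then have "prob {\<omega> \<in> space P. \<exists>z. 0 < \<omega> (0, 0) z \<and> \<omega> (0, 0) z < 1} = 0"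
    proof (subst prob_Collect_eq_0)
      note [measurable] = measurable_P[OF env_coordinate_measurable]
      show "{\<omega> \<in> space P. \<exists>z. 0 < \<omega> (0, 0) z \<and> \<omega> (0, 0) z < 1} \<in> sets P" by measurable
    qed
    with nd show False unfolding nondegenerate_environment_def by simp
  qed
  then obtain z z' where zz: "z \<in> jumps" "z' \<in> jumps" "z \<noteq> z'" "jump_moment z z' > 0" by blast
  from zz(3) have "AE \<theta> in torus_measure. cos (\<theta> \<bullet> real_vec (z - z')) < 1"
    by (intro AE_cos_less_1) simp
  then show ?thesis
  proof eventually_elim
    case (elim \<theta>)
    have nn: "0 \<le> jump_moment u v * (1 - cos (\<theta> \<bullet> real_vec (u - v)))" for u v
      by (intro mult_nonneg_nonneg jump_moment_nonneg) simp
    have "0 < jump_moment z z' * (1 - cos (\<theta> \<bullet> real_vec (z - z')))"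
      using zz(4) elim by simp
    also have "\<dots> \<le> (\<Sum>v\<in>jumps. jump_moment z v * (1 - cos (\<theta> \<bullet> real_vec (z - v))))"
      by (rule member_le_sum[OF zz(2) _ finite_jumps]) (rule nn)
    also have "\<dots> \<le> 1 - lam P \<theta>"
      unfolding one_minus_lam
      by (rule member_le_sum[OF zz(1) _ finite_jumps, of "\<lambda>u. \<Sum>v\<in>jumps. jump_moment u v * (1 - cos (\<theta> \<bullet> real_vec (u - v)))"])
         (intro sum_nonneg nn)
    finally show ?case by simp
  qed
qed

section \<open>Correlations in Fourier variables\<close>

text \<open>The limit of the Fourier transform of the centred correlations is a multiple of \<open>gap_ratio\<close>; almost
  everywhere it is the complement of the integrand of \<open>\<beta>\<close>. Where \<open>lam_bar P \<theta> = 1\<close>, both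
  quotients are \<open>0 / 0 = 0\<close>.\<close>

definition gap_ratio :: "real ^ 'd \<Rightarrow> real" where
  "gap_ratio \<theta> = (lam P \<theta> - lam_bar P \<theta>) / (1 - lam_bar P \<theta>)"

definition beta_integrand :: "real ^ 'd \<Rightarrow> real" where
  "beta_integrand \<theta> = (1 - lam P \<theta>) / (1 - lam_bar P \<theta>)"

text \<open>The Fourier transform of \<open>correlation N - 1\<close>. Away from the origin the difference walk acts as
  multiplication by \<open>lam_bar P\<close>; the perturbation at the origin is a source with Fourier
  transform \<open>lam P - lam_bar P\<close>, weighted with the correlation at \<open>0\<close>.\<close>

primrec correlation_hat :: "nat \<Rightarrow> real ^ 'd \<Rightarrow> real" where
  "correlation_hat 0 \<theta> = 0"
| "correlation_hat (Suc N) \<theta> =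
     lam_bar P \<theta> * correlation_hat N \<theta> + correlation N 0 * (lam P \<theta> - lam_bar P \<theta>)"

lemma gap_ratio_measurable [measurable]: "gap_ratio \<in> borel_measurable borel"
  unfolding gap_ratio_def by measurable

lemma beta_integrand_measurable [measurable]: "beta_integrand \<in> borel_measurable borel"
  unfolding beta_integrand_def by measurable

lemma correlation_hat_measurable [measurable]: "correlation_hat N \<in> borel_measurable borel"
proof (induction N)
  case 0
  have "correlation_hat 0 = (\<lambda>\<theta>. 0)" by auto
  then show ?case by simp
next
  case (Suc N)
  note [measurable] = Suc
  have "correlation_hat (Suc N) = (\<lambda>\<theta>.
      lam_bar P \<theta> * correlation_hat N \<theta> + correlation N 0 * (lam P \<theta> - lam_bar P \<theta>))" by auto
  then show ?case by simp
qed

lemma gap_ratio_bounds: "0 \<le> gap_ratio \<theta>" "gap_ratio \<theta> \<le> 1"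
  and beta_integrand_bounds: "0 \<le> beta_integrand \<theta>" "beta_integrand \<theta> \<le> 1"
  unfolding gap_ratio_def beta_integrand_def
  using lam_bar_le_lam[of \<theta>] lam_le_1[of \<theta>] lam_bar_nonneg[of \<theta>]
  by (auto simp: divide_le_eq_1 intro!: divide_nonneg_nonneg)

lemma gap_eq: "lam P \<theta> - lam_bar P \<theta> = gap_ratio \<theta> * (1 - lam_bar P \<theta>)"
  unfolding gap_ratio_def using lam_bar_le_lam[of \<theta>] lam_le_1[of \<theta>] by auto

lemma gap_ratio_eq: "lam_bar P \<theta> < 1 \<Longrightarrow> gap_ratio \<theta> = 1 - beta_integrand \<theta>"
  unfolding gap_ratio_def beta_integrand_def by (simp add: field_simps)

lemma correlation_ge_1: "1 \<le> correlation N 0"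
  using monoD[OF correlation_mono, of 0 N] by simp

text \<open>With a constant source \<open>a\<close> the recursion has the fixed point \<open>a * gap_ratio\<close>; since the actual
  sources increase with \<open>N\<close>, the iterates stay below the fixed point of the current source.\<close>

lemma correlation_hat_bounds:
  "0 \<le> correlation_hat N \<theta>" "correlation_hat N \<theta> \<le> correlation N 0 * gap_ratio \<theta>"
proof -
  have "0 \<le> correlation_hat N \<theta> \<and> correlation_hat N \<theta> \<le> correlation N 0 * gap_ratio \<theta>"
  proof (induction N)
    case (Suc N)
    have a: "0 \<le> correlation N 0" using correlation_ge_1[of N] by simp
    have "lam_bar P \<theta> * correlation_hat N \<theta> \<le> lam_bar P \<theta> * (correlation N 0 * gap_ratio \<theta>)"
      using Suc by (intro mult_left_mono lam_bar_nonneg) auto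
    then have "correlation_hat (Suc N) \<theta> \<le> correlation N 0 * gap_ratio \<theta>"
      unfolding correlation_hat.simps gap_eq by (simp add: algebra_simps)
    also have "\<dots> \<le> correlation (Suc N) 0 * gap_ratio \<theta>"
      using monoD[OF correlation_mono, of N "Suc N"] by (intro mult_right_mono gap_ratio_bounds) auto
    finally show ?case
      using Suc a lam_bar_le_lam[of \<theta>] lam_bar_nonneg[of \<theta>] by simp
  qed (simp add: gap_ratio_bounds)
  then show "0 \<le> correlation_hat N \<theta>" "correlation_hat N \<theta> \<le> correlation N 0 * gap_ratio \<theta>" by auto
qed

lemma correlation_hat_le: "correlation_hat N \<theta> \<le> correlation N 0"
proof -
  have "correlation N 0 * gap_ratio \<theta> \<le> correlation N 0 * 1"
    using correlation_ge_1[of N] by (intro mult_left_mono gap_ratio_bounds) auto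
  with correlation_hat_bounds(2)[of N \<theta>] show ?thesis by simp
qed

lemma correlation_hat_mono: "mono (\<lambda>N. correlation_hat N \<theta>)"
proof (rule incseq_SucI)
  show "correlation_hat N \<theta> \<le> correlation_hat (Suc N) \<theta>" for N
  proof (induction N)
    case 0
    then show ?case using correlation_hat_bounds(1)[of "Suc 0" \<theta>] by simp
  next
    case (Suc N)
    have "lam_bar P \<theta> * correlation_hat N \<theta> \<le> lam_bar P \<theta> * correlation_hat (Suc N) \<theta>"
      by (intro mult_left_mono lam_bar_nonneg Suc)
    moreover have "correlation N 0 * (lam P \<theta> - lam_bar P \<theta>) \<le> correlation (Suc N) 0 * (lam P \<theta> - lam_bar P \<theta>)"
      using monoD[OF correlation_mono, of N "Suc N"] lam_bar_le_lam[of \<theta>]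
      by (intro mult_right_mono) auto
    ultimately show ?case
      unfolding correlation_hat.simps(2)[of "Suc N"] by (subst correlation_hat.simps(2)) linarith
  qed
qed

text \<open>The recursion for the correlations, centred at \<open>1\<close> and split into the unperturbed difference walk
  and the correction for two walks at a common site.\<close>

lemma correlation_Suc:
  "correlation (Suc N) m - 1 =
    (\<Sum>u\<in>jumps. \<Sum>v\<in>jumps. mean_kernel P u * mean_kernel P v * (correlation N (m + u - v) - 1)) +
    correlation N 0 * (\<Sum>u\<in>jumps. \<Sum>v\<in>jumps.
      (jump_moment u v - mean_kernel P u * mean_kernel P v) * (if m + u - v = 0 then 1 else 0))"
proof -
  have one: "(\<Sum>u\<in>jumps. \<Sum>v\<in>jumps. mean_kernel P u * mean_kernel P v) = 1"
    by (simp flip: sum_product add: sum_mean_kernel)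
  have "correlation (Suc N) m = (\<Sum>u\<in>jumps. \<Sum>v\<in>jumps.
      mean_kernel P u * mean_kernel P v * (correlation N (m + u - v) - 1) +
      (correlation N 0 * ((jump_moment u v - mean_kernel P u * mean_kernel P v) * (if m + u - v = 0 then 1 else 0)) +
      mean_kernel P u * mean_kernel P v))"
    unfolding correlation.simps by (intro sum.cong refl) (auto simp: algebra_simps)
  then show ?thesis unfolding sum.distrib one sum_distrib_left by simp
qed

text \<open>Multiplication of the transform by \<open>cis (\<theta> \<bullet> (u - v))\<close> shifts its coefficients by \<open>u - v\<close>, so the
  expansions of \<open>lam P\<close> and \<open>lam_bar P\<close> translate the recursion for the transform into the
  centred recursion for the correlations.\<close>

lemma correlation_hat_fourier_complex:
  "(\<integral>\<theta>. complex_of_real (correlation_hat N \<theta>) * cis (\<theta> \<bullet> real_vec m) \<partial>torus_measure) =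
    of_real (correlation N m - 1)"
proof (induction N arbitrary: m)
  case 0
  then show ?case by simp
next
  case (Suc N)
  let ?p = "mean_kernel P" and ?a = "correlation N 0"
  have int: "integrable torus_measure (\<lambda>\<theta>. complex_of_real (correlation_hat N \<theta>) * cis (\<theta> \<bullet> real_vec z))" for z
    by (rule integrable_torus_measure_bounded[of _ ?a])
       (measurable, simp add: norm_mult correlation_hat_bounds(1) correlation_hat_le)
  have int1: "integrable torus_measure (\<lambda>\<theta> :: real ^ 'd. cis (\<theta> \<bullet> real_vec z))" for z
    by (rule integrable_torus_measure_bounded[of _ 1]) simp_all
  have cis: "cis (\<theta> \<bullet> real_vec (u - v)) * cis (\<theta> \<bullet> real_vec m) = cis (\<theta> \<bullet> real_vec (m + u - v))" for \<theta> u v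
    by (simp add: cis_mult real_vec_diff real_vec_add inner_diff_right inner_add_right algebra_simps)
  have bar: "complex_of_real (lam_bar P \<theta>) * cis (\<theta> \<bullet> real_vec m) =
      (\<Sum>u\<in>jumps. \<Sum>v\<in>jumps. of_real (?p u * ?p v) * cis (\<theta> \<bullet> real_vec (m + u - v)))" for \<theta>
    by (simp only: lam_bar_expansion sum_distrib_right mult.assoc cis)
  have lam: "complex_of_real (lam P \<theta>) * cis (\<theta> \<bullet> real_vec m) =
      (\<Sum>u\<in>jumps. \<Sum>v\<in>jumps. of_real (jump_moment u v) * cis (\<theta> \<bullet> real_vec (m + u - v)))" for \<theta>
    by (simp only: lam_expansion sum_distrib_right mult.assoc cis)
  have "complex_of_real (correlation_hat (Suc N) \<theta>) * cis (\<theta> \<bullet> real_vec m) =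
      (complex_of_real (lam_bar P \<theta>) * cis (\<theta> \<bullet> real_vec m)) * of_real (correlation_hat N \<theta>) +
      of_real ?a * (complex_of_real (lam P \<theta>) * cis (\<theta> \<bullet> real_vec m) -
        complex_of_real (lam_bar P \<theta>) * cis (\<theta> \<bullet> real_vec m))" for \<theta>
    by (simp add: algebra_simps)
  also have "\<dots> \<theta> = (\<Sum>u\<in>jumps. \<Sum>v\<in>jumps. of_real (?p u * ?p v) *
        (complex_of_real (correlation_hat N \<theta>) * cis (\<theta> \<bullet> real_vec (m + u - v)))) +
      of_real ?a * (\<Sum>u\<in>jumps. \<Sum>v\<in>jumps. of_real (jump_moment u v - ?p u * ?p v) *
        cis (\<theta> \<bullet> real_vec (m + u - v)))" for \<theta>
  proof -
    have s1: "(\<Sum>u\<in>jumps. \<Sum>v\<in>jumps. of_real (?p u * ?p v) * cis (\<theta> \<bullet> real_vec (m + u - v))) *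
        complex_of_real (correlation_hat N \<theta>) = (\<Sum>u\<in>jumps. \<Sum>v\<in>jumps. of_real (?p u * ?p v) *
        (complex_of_real (correlation_hat N \<theta>) * cis (\<theta> \<bullet> real_vec (m + u - v))))"
      unfolding sum_distrib_right by (intro sum.cong refl) (simp only: mult_ac)
    have s2: "(\<Sum>u\<in>jumps. \<Sum>v\<in>jumps. of_real (jump_moment u v) * cis (\<theta> \<bullet> real_vec (m + u - v))) -
        (\<Sum>u\<in>jumps. \<Sum>v\<in>jumps. of_real (?p u * ?p v) * cis (\<theta> \<bullet> real_vec (m + u - v))) =
        (\<Sum>u\<in>jumps. \<Sum>v\<in>jumps. of_real (jump_moment u v - ?p u * ?p v) *
        cis (\<theta> \<bullet> real_vec (m + u - v)))"
      unfolding sum_subtractf[symmetric] by (intro sum.cong refl) (simp only: of_real_diff left_diff_distrib)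
    show ?thesis unfolding bar lam s1 s2 ..
  qed
  finally have "(\<integral>\<theta>. complex_of_real (correlation_hat (Suc N) \<theta>) * cis (\<theta> \<bullet> real_vec m) \<partial>torus_measure) =
    (\<integral>\<theta>. (\<Sum>u\<in>jumps. \<Sum>v\<in>jumps. of_real (?p u * ?p v) *
        (complex_of_real (correlation_hat N \<theta>) * cis (\<theta> \<bullet> real_vec (m + u - v)))) +
      of_real ?a * (\<Sum>u\<in>jumps. \<Sum>v\<in>jumps. of_real (jump_moment u v - ?p u * ?p v) *
        cis (\<theta> \<bullet> real_vec (m + u - v))) \<partial>torus_measure)"
    by (simp only:)
  also have "\<dots> = (\<Sum>u\<in>jumps. \<Sum>v\<in>jumps. of_real (?p u * ?p v) *
        of_real (correlation N (m + u - v) - 1)) +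
      of_real ?a * (\<Sum>u\<in>jumps. \<Sum>v\<in>jumps. of_real (jump_moment u v - ?p u * ?p v) *
        (if m + u - v = 0 then 1 else 0))"
    by (simp only: Bochner_Integration.integral_add Bochner_Integration.integral_sum
        Bochner_Integration.integrable_sum integrable_mult_right integral_mult_right_zero int int1
        Suc.IH fourier_orthogonality)
  also have "\<dots> = of_real (correlation (Suc N) m - 1)"
    unfolding correlation_Suc by (simp add: of_real_sum if_distrib[of complex_of_real] cong: if_cong)
  finally show ?case .
qed

lemma correlation_hat_fourier:
  "(\<integral>\<theta>. correlation_hat N \<theta> * cos (\<theta> \<bullet> real_vec m) \<partial>torus_measure) = correlation N m - 1"
proof -
  have int: "integrable torus_measure (\<lambda>\<theta>. complex_of_real (correlation_hat N \<theta>) * cis (\<theta> \<bullet> real_vec m))"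
    by (rule integrable_torus_measure_bounded[of _ "correlation N 0"])
       (measurable, simp add: norm_mult correlation_hat_bounds(1) correlation_hat_le)
  have "(\<integral>\<theta>. Re (complex_of_real (correlation_hat N \<theta>) * cis (\<theta> \<bullet> real_vec m)) \<partial>torus_measure) =
      Re (of_real (correlation N m - 1))"
    unfolding integral_Re[OF int] correlation_hat_fourier_complex ..
  then show ?thesis by simp
qed

lemma cos_fourier: "(\<integral>\<theta>. cos (\<theta> \<bullet> real_vec (m :: int ^ 'd)) \<partial>torus_measure) = (if m = 0 then 1 else 0)"
proof -
  have int: "integrable torus_measure (\<lambda>\<theta>. cis (\<theta> \<bullet> real_vec m))"
    by (rule integrable_torus_measure_bounded[of _ 1]) simp_all
  have "(\<integral>\<theta>. Re (cis (\<theta> \<bullet> real_vec m)) \<partial>torus_measure) = Re (if m = 0 then 1 else 0)"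
    unfolding integral_Re[OF int] fourier_orthogonality ..
  then show ?thesis by simp
qed

lemma beta_eq: "beta P = (\<integral>\<theta>. beta_integrand \<theta> \<partial>torus_measure)"
  unfolding integral_torus_measure[OF beta_integrand_measurable]
  unfolding beta_def beta_integrand_def by simp

lemma beta_pos:
  assumes "nondegenerate_environment P"
  shows "0 < beta P"
proof -
  have nn: "0 \<le> beta P"
    unfolding beta_eq by (intro Bochner_Integration.integral_nonneg beta_integrand_bounds)
  have "beta P \<noteq> 0"
  proof
    assume "beta P = 0"
    have "integrable torus_measure beta_integrand"
      by (rule integrable_torus_measure_bounded[of _ 1]) (auto simp: beta_integrand_bounds abs_of_nonneg)
    then have "AE \<theta> in torus_measure. beta_integrand \<theta> = 0"
      using \<open>beta P = 0\<close> unfolding beta_eq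
      by (subst (asm) integral_nonneg_eq_0_iff_AE) (auto simp: beta_integrand_bounds)
    with AE_lam_less_1[OF assms] have "AE \<theta> in (torus_measure :: (real ^ 'd) measure). False"
    proof eventually_elim
      case (elim \<theta>)
      then show False using lam_bar_le_lam[of \<theta>] by (auto simp: beta_integrand_def)
    qed
    then show False by (simp add: torus.AE_False)
  qed
  with nn show ?thesis by simp
qed

lemma gap_ratio_fourier:
  assumes "nondegenerate_environment P"
  shows "(\<integral>\<theta>. gap_ratio \<theta> * cos (\<theta> \<bullet> real_vec m) \<partial>torus_measure) =
    (if m = 0 then 1 else 0) - (\<integral>\<theta>. beta_integrand \<theta> * cos (\<theta> \<bullet> real_vec m) \<partial>torus_measure)"
proof -
  have bound: "\<bar>beta_integrand \<theta> * cos (\<theta> \<bullet> real_vec m)\<bar> \<le> 1" for \<theta>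
    unfolding abs_mult by (intro mult_le_one) (auto simp: beta_integrand_bounds abs_of_nonneg)
  have int: "integrable torus_measure (\<lambda>\<theta>. cos (\<theta> \<bullet> real_vec m))"
      "integrable torus_measure (\<lambda>\<theta>. beta_integrand \<theta> * cos (\<theta> \<bullet> real_vec m))"
    by (rule integrable_torus_measure_bounded[of _ 1]; simp add: bound)+
  have ae: "AE \<theta> in torus_measure. gap_ratio \<theta> * cos (\<theta> \<bullet> real_vec m) =
      cos (\<theta> \<bullet> real_vec m) - beta_integrand \<theta> * cos (\<theta> \<bullet> real_vec m)"
    using AE_lam_less_1[OF assms]
  proof eventually_elim
    case (elim \<theta>)
    then have "lam_bar P \<theta> < 1" using lam_bar_le_lam[of \<theta>] by simp
    then show ?case by (simp add: gap_ratio_eq left_diff_distrib)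
  qed
  have "(\<integral>\<theta>. gap_ratio \<theta> * cos (\<theta> \<bullet> real_vec m) \<partial>torus_measure) =
      (\<integral>\<theta>. cos (\<theta> \<bullet> real_vec m) - beta_integrand \<theta> * cos (\<theta> \<bullet> real_vec m) \<partial>torus_measure)"
    by (rule integral_cong_AE) (use ae in auto)
  then show ?thesis by (simp add: int cos_fourier)
qed

text \<open>Integrating the upper bound for the transform gives
  \<open>a\<^sub>N - 1 \<le> a\<^sub>N (1 - \<beta>)\<close> for \<open>a\<^sub>N = correlation N 0\<close>. As \<open>\<beta> > 0\<close>, the increasing sequence \<open>a\<^sub>N\<close> has
  a finite limit \<open>a\<close>, the transforms increase to \<open>a * gap_ratio\<close> almost everywhere, and dominated
  convergence gives the limit of each correlation in terms of \<open>a\<close>. For \<open>m = 0\<close> this reads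
  \<open>a = 1 + a (1 - \<beta>)\<close>, which determines \<open>a = 1 / \<beta>\<close>.\<close>

lemma correlation_limit:
  assumes nd: "nondegenerate_environment P"
  shows "(\<lambda>N. correlation N m) \<longlonglongrightarrow> 1 + inverse (beta P) *
    ((if m = 0 then 1 else 0) - (\<integral>\<theta>. beta_integrand \<theta> * cos (\<theta> \<bullet> real_vec m) \<partial>torus_measure))"
proof -
  have bound: "correlation N 0 \<le> inverse (beta P)" for N
  proof -
    have "integrable torus_measure (correlation_hat N)"
      by (rule integrable_torus_measure_bounded[of _ "correlation N 0"])
         (auto simp: correlation_hat_bounds(1) correlation_hat_le)
    moreover have "integrable torus_measure gap_ratio"
      by (rule integrable_torus_measure_bounded[of _ 1]) (auto simp: gap_ratio_bounds abs_of_nonneg)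
    ultimately have "(\<integral>\<theta>. correlation_hat N \<theta> \<partial>torus_measure) \<le>
        (\<integral>\<theta>. correlation N 0 * gap_ratio \<theta> \<partial>torus_measure)"
      by (intro integral_mono correlation_hat_bounds) auto
    then have "correlation N 0 - 1 \<le> correlation N 0 * (1 - beta P)"
      using correlation_hat_fourier[of N 0] gap_ratio_fourier[OF nd, of 0]
      by (simp add: real_vec_0 beta_eq)
    then have "correlation N 0 * beta P \<le> 1" by (simp add: algebra_simps)
    then show ?thesis using beta_pos[OF nd] by (simp add: field_simps)
  qed
  obtain a where a: "(\<lambda>N. correlation N 0) \<longlonglongrightarrow> a" "\<And>N. correlation N 0 \<le> a"
    using incseq_convergent[OF correlation_mono] bound by auto
  have hat: "AE \<theta> in torus_measure. (\<lambda>N. correlation_hat N \<theta> * cos (\<theta> \<bullet> real_vec k)) \<longlonglongrightarrow>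
      a * gap_ratio \<theta> * cos (\<theta> \<bullet> real_vec k)" for k
    using AE_lam_less_1[OF nd]
  proof eventually_elim
    case (elim \<theta>)
    then have bar: "lam_bar P \<theta> < 1" using lam_bar_le_lam[of \<theta>] by simp
    \<comment> \<open>A bounded increasing solution of the affine recursion converges to its fixed point.\<close>
    have "correlation_hat N \<theta> \<le> a" for N
      using correlation_hat_le[of N \<theta>] a(2)[of N] by simp
    then obtain l where l: "(\<lambda>N. correlation_hat N \<theta>) \<longlonglongrightarrow> l"
      using incseq_convergent[OF correlation_hat_mono] by blast
    have "(\<lambda>N. correlation_hat (Suc N) \<theta>) \<longlonglongrightarrow> lam_bar P \<theta> * l + a * (lam P \<theta> - lam_bar P \<theta>)"
      unfolding correlation_hat.simps by (intro tendsto_intros l a)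
    from LIMSEQ_unique[OF this LIMSEQ_Suc[OF l]] have "l = a * gap_ratio \<theta>"
      using bar unfolding gap_ratio_def by (simp add: field_simps)
    with l show ?case by (intro tendsto_intros) simp
  qed
  have conv: "(\<lambda>N. correlation N k) \<longlonglongrightarrow> 1 + a *
    ((if k = 0 then 1 else 0) - (\<integral>\<theta>. beta_integrand \<theta> * cos (\<theta> \<bullet> real_vec k) \<partial>torus_measure))" for k
  proof -
    have "(\<lambda>N. \<integral>\<theta>. correlation_hat N \<theta> * cos (\<theta> \<bullet> real_vec k) \<partial>torus_measure) \<longlonglongrightarrow>
        (\<integral>\<theta>. a * gap_ratio \<theta> * cos (\<theta> \<bullet> real_vec k) \<partial>torus_measure)"
    proof (rule integral_dominated_convergence[where w = "\<lambda>_. a"])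
      fix N
      have "\<bar>correlation_hat N \<theta> * cos (\<theta> \<bullet> real_vec k)\<bar> \<le> a * 1" for \<theta>
        unfolding abs_mult
        using correlation_hat_bounds(1)[of N \<theta>] correlation_hat_le[of N \<theta>] a(2)[of N]
        by (intro mult_mono) auto
      then show "AE \<theta> in torus_measure. norm (correlation_hat N \<theta> * cos (\<theta> \<bullet> real_vec k)) \<le> a" by simp
    qed (use hat in auto)
    then have "(\<lambda>N. 1 + (correlation N k - 1)) \<longlonglongrightarrow>
        1 + (\<integral>\<theta>. a * (gap_ratio \<theta> * cos (\<theta> \<bullet> real_vec k)) \<partial>torus_measure)"
      unfolding correlation_hat_fourier mult.assoc by (intro tendsto_intros)
    then show ?thesis by (simp add: gap_ratio_fourier[OF nd])
  qed
  have "a = 1 + a * (1 - beta P)"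
    using LIMSEQ_unique[OF a(1) conv[of 0]] by (simp add: real_vec_0 beta_eq)
  then have "a * beta P = 1" by (simp add: algebra_simps)
  then have "a = inverse (beta P)" using beta_pos[OF nd] by (simp add: field_simps)
  with conv show ?thesis by simp
qed

end

section \<open>Covariance of the density\<close>

theorem theorem1p2:
  fixes P :: "('d::finite) env measure" and R :: real
  assumes "prob_space P"
    and "sets P = sets (env_space R)"
    and "iid_environment P"
    and "nondegenerate_environment P"
    and "aperiodic_environment P"
  shows "(\<forall>m :: int ^ 'd. m \<noteq> 0 \<longrightarrow>
            prob_space.covariance P quenched_density (\<lambda>\<omega>. quenched_density (env_shift m 0 \<omega>)) =
              - (inverse (beta P) / (2 * pi) ^ CARD('d)) *
                (LINT \<theta>:torus|lborel.
                   cos (\<theta> \<bullet> real_vec m) * ((1 - lam P \<theta>) / (1 - lam_bar P \<theta>)))) \<and>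
         prob_space.variance P quenched_density = inverse (beta P) - 1"
proof -
  interpret prob_space P by fact
  interpret iid_random_environment P R by unfold_locales fact+
  note nd = \<open>nondegenerate_environment P\<close>
  note lim = correlation_limit[OF nd]
  show ?thesis
  proof (intro conjI allI impI)
    fix m :: "int ^ 'd" assume m: "m \<noteq> 0"
    have meas: "(\<lambda>\<theta>. beta_integrand \<theta> * cos (\<theta> \<bullet> real_vec m)) \<in> borel_measurable borel" by measurable
    have "covariance quenched_density (\<lambda>\<omega>. quenched_density (env_shift m 0 \<omega>)) =
        - inverse (beta P) * (\<integral>\<theta>. beta_integrand \<theta> * cos (\<theta> \<bullet> real_vec m) \<partial>torus_measure)"
      using quenched_density_covariance[OF lim, of m] m by simp
    then show "covariance quenched_density (\<lambda>\<omega>. quenched_density (env_shift m 0 \<omega>)) =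
        - (inverse (beta P) / (2 * pi) ^ CARD('d)) *
          (LINT \<theta>:torus|lborel. cos (\<theta> \<bullet> real_vec m) * ((1 - lam P \<theta>) / (1 - lam_bar P \<theta>)))"
      unfolding integral_torus_measure[OF meas]
      unfolding beta_integrand_def by (simp add: mult.commute)
  next
    have "variance quenched_density = inverse (beta P) * (1 - beta P)"
      using quenched_density_variance[OF lim] by (simp add: real_vec_0 beta_eq)
    then show "variance quenched_density = inverse (beta P) - 1"
      using beta_pos[OF nd] by (simp add: right_diff_distrib)
  qed
qed

end
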